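(* Let $z\ge0$ and let $\lambda\ge0$ be loop activities satisfying the assumptions in the context. For every self-avoiding walk $\eta$ on $\mathbb{Z}^d$, $$\bar w_{\lambda,z}(\eta)=\sum_{\omega:\ \mathrm{LE}(\omega)=\eta}w_{\lambda,z}(\omega)=z^{|\eta|}\exp\big(\mu_{\lambda,z}(\mathrm{range}(\eta))\big).$$
   Context: Vertices $x,y\in\mathbb{Z}^d$ are adjacent if they are at Euclidean distance $1$. An $n$-step walk ($n\ge0$) is a sequence $\omega=(\omega_0,\dots,\omega_n)$ of vertices with consecutive vertices adjacent; $|\omega|=n$, $\omega:x\to y$ means $\omega_0=x$ and $\omega_{|\omega|}=y$, and $\mathrm{range}(\omega)$ is the set of vertices visited. A walk is self-avoiding if its vertices are distinct. A self-avoiding polygon is a walk $\eta$ with $|\eta|\ge2$, $\eta_0=\eta_{|\eta|}$ and no other coincidences $\eta_i=\eta_j$, $i\neq j$. Loop erasure: if $\omega$ is not self-avoiding, let $\tau_\omega=\min\{i : \exists\, j<i,\ \omega_j=\omega_i\}$ and $\tau^\star_\omega=\min\{j:\omega_j=\omega_{\tau_\omega}\}$; a single loop erasure replaces $\omega$ by $(\omega_0,\dots,\omega_{\tau^\star_\omega},\omega_{\tau_\omega+1},\dots,\omega_n)$ and removes the self-avoiding polygon $(\omega_{\tau_\omega^\star},\dots,\omega_{\tau_\omega})$. $\mathrm{LE}(\omega)$ is the self-avoiding walk obtained by iterating this. $n_L^\eta(\omega)$ is the number of times the self-avoiding polygon $\eta$ is removed. Activities: $\lambda=(\lambda_\eta)$,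 $\lambda_\eta\ge0$ for each self-avoiding polygon $\eta$, with $\sup_\eta\lambda_\eta<\infty$, $\lambda_\eta=\lambda_{\mathcal{R}\eta}$ for every isometry $\mathcal{R}$ of $\mathbb{Z}^d$, and $\lambda_\eta=\lambda_{\tilde\eta}$ if $\eta,\tilde\eta$ differ only in initial vertex and orientation. Weight: $w_{\lambda,z}(\omega)=z^{|\omega|}\prod_\eta\lambda_\eta^{n_L^\eta(\omega)}$ ($0^0=1$). The loop-erased $\lambda$-LWW weight of a self-avoiding walk $\eta$ is $\bar w_{\lambda,z}(\eta)=\sum_{\omega:\mathrm{LE}(\omega)=\eta}w_{\lambda,z}(\omega)$. The $\lambda$-LWW loop measure is, for $A\subset\mathbb{Z}^d$, $$\mu_{\lambda,z}(A)=\sum_{x\in\mathbb{Z}^d}\ \sum_{\omega:x\to x,\ |\omega|\ge1}\mathbf{1}\{\mathrm{range}(\omega)\cap A\ne\emptyset\}\frac{w_{\lambda,z}(\omega)}{|\omega|}.$$ All sums have non-negative terms and take values in $[0,\infty]$. *)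

theory Defs
  imports "HOL-Analysis.Analysis"
begin

type_synonym 'd vertex = "int ^ 'd"

definition real_vec :: "'d::finite vertex \<Rightarrow> real ^ 'd" where
  "real_vec x = (\<chi> i. real_of_int (x $ i))"

definition adjacent :: "'d::finite vertex \<Rightarrow> 'd vertex \<Rightarrow> bool" where
  "adjacent x y \<longleftrightarrow> dist (real_vec x) (real_vec y) = 1"

text \<open>An n-step walk is the list of its n + 1 vertices; \<open>set \<omega>\<close> is its range.\<close>

definition walk :: "'d::finite vertex list \<Rightarrow> bool" where
  "walk \<omega> \<longleftrightarrow> \<omega> \<noteq> [] \<and> (\<forall>i. Suc i < length \<omega> \<longrightarrow> adjacent (\<omega> ! i) (\<omega> ! Suc i))"

definition steps :: "'d vertex list \<Rightarrow> nat" where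
  "steps \<omega> = length \<omega> - 1"

definition walk_from_to :: "'d::finite vertex list \<Rightarrow> 'd vertex \<Rightarrow> 'd vertex \<Rightarrow> bool" where
  "walk_from_to \<omega> x y \<longleftrightarrow> walk \<omega> \<and> \<omega> ! 0 = x \<and> \<omega> ! steps \<omega> = y"

definition self_avoiding_walk :: "'d::finite vertex list \<Rightarrow> bool" where
  "self_avoiding_walk \<omega> \<longleftrightarrow> walk \<omega> \<and> distinct \<omega>"

definition self_avoiding_polygon :: "'d::finite vertex list \<Rightarrow> bool" where
  "self_avoiding_polygon \<eta> \<longleftrightarrow> walk \<eta> \<and> 2 \<le> steps \<eta> \<and> \<eta> ! 0 = \<eta> ! steps \<eta> \<and>
     (\<forall>i j. i < j \<and> j \<le> steps \<eta> \<and> \<eta> ! i = \<eta> ! j \<longrightarrow> i = 0 \<and> j = steps \<eta>)"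

text \<open>
  The functions below are meaningful when \<open>\<omega>\<close> is not self-avoiding; \<open>loop_end\<close> and
  \<open>loop_start\<close> are the times \<open>\<tau>\<close> and \<open>\<tau>\<close>-star of the first loop to be closed.
\<close>

definition loop_end :: "'d vertex list \<Rightarrow> nat" where
  "loop_end \<omega> = (LEAST i. i < length \<omega> \<and> (\<exists>j<i. \<omega> ! j = \<omega> ! i))"

definition loop_start :: "'d vertex list \<Rightarrow> nat" where
  "loop_start \<omega> = (LEAST j. \<omega> ! j = \<omega> ! loop_end \<omega>)"

definition single_loop_erasure :: "'d vertex list \<Rightarrow> 'd vertex list" where
  "single_loop_erasure \<omega> = take (Suc (loop_start \<omega>)) \<omega> @ drop (Suc (loop_end \<omega>)) \<omega>"

definition removed_loop :: "'d vertex list \<Rightarrow> 'd vertex list" where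
  "removed_loop \<omega> = drop (loop_start \<omega>) (take (Suc (loop_end \<omega>)) \<omega>)"

lemma loop_end_props:
  assumes "\<not> distinct \<omega>"
  shows "loop_end \<omega> < length \<omega>" "\<exists>j<loop_end \<omega>. \<omega> ! j = \<omega> ! loop_end \<omega>"
proof -
  obtain i j where "i < length \<omega>" "j < length \<omega>" "i \<noteq> j" "\<omega> ! i = \<omega> ! j"
    using assms by (auto simp: distinct_conv_nth)
  then have "\<exists>i. i < length \<omega> \<and> (\<exists>j<i. \<omega> ! j = \<omega> ! i)"
    by (metis linorder_neqE_nat)
  then have "loop_end \<omega> < length \<omega> \<and> (\<exists>j<loop_end \<omega>. \<omega> ! j = \<omega> ! loop_end \<omega>)"
    unfolding loop_end_def by (rule LeastI_ex)
  then show "loop_end \<omega> < length \<omega>" "\<exists>j<loop_end \<omega>. \<omega> ! j = \<omega> ! loop_end \<omega>"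
    by auto
qed

lemma loop_start_props:
  assumes "\<not> distinct \<omega>"
  shows "loop_start \<omega> < loop_end \<omega>" "\<omega> ! loop_start \<omega> = \<omega> ! loop_end \<omega>"
proof -
  obtain j where j: "j < loop_end \<omega>" "\<omega> ! j = \<omega> ! loop_end \<omega>"
    using loop_end_props(2)[OF assms] by blast
  show "\<omega> ! loop_start \<omega> = \<omega> ! loop_end \<omega>"
    unfolding loop_start_def using j(2) by (rule LeastI)
  have "loop_start \<omega> \<le> j"
    unfolding loop_start_def using j(2) by (rule Least_le)
  then show "loop_start \<omega> < loop_end \<omega>" using j(1) by simp
qed

lemma length_single_loop_erasure:
  "\<not> distinct \<omega> \<Longrightarrow> length (single_loop_erasure \<omega>) < length \<omega>"
  using loop_end_props(1)[of \<omega>] loop_start_props(1)[of \<omega>]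
  by (simp add: single_loop_erasure_def)

function LE :: "'d vertex list \<Rightarrow> 'd vertex list" where
  "LE \<omega> = (if distinct \<omega> then \<omega> else LE (single_loop_erasure \<omega>))"
  by pat_completeness auto
termination
  by (relation "Wellfounded.measure length") (auto simp: length_single_loop_erasure)

function removed_loops :: "'d vertex list \<Rightarrow> 'd vertex list list" where
  "removed_loops \<omega> =
     (if distinct \<omega> then [] else removed_loop \<omega> # removed_loops (single_loop_erasure \<omega>))"
  by pat_completeness auto
termination
  by (relation "Wellfounded.measure length") (auto simp: length_single_loop_erasure)

declare LE.simps [simp del] removed_loops.simps [simp del]

definition n_L :: "'d vertex list \<Rightarrow> 'd vertex list \<Rightarrow> nat" where
  "n_L \<eta> \<omega> = count_list (removed_loops \<omega>) \<eta>"

definition lattice_isometry :: "('d::finite vertex \<Rightarrow> 'd vertex) \<Rightarrow> bool" where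
  "lattice_isometry R \<longleftrightarrow> bij R \<and>
     (\<forall>x y. dist (real_vec (R x)) (real_vec (R y)) = dist (real_vec x) (real_vec y))"

text \<open>
  A polygon repeats its initial vertex at the end, so \<open>butlast\<close> is its list of distinct vertices
  in cyclic order; moving the initial vertex rotates this list, and changing the orientation
  reverses it.
\<close>

definition same_unrooted_polygon :: "'d vertex list \<Rightarrow> 'd vertex list \<Rightarrow> bool" where
  "same_unrooted_polygon \<eta> \<eta>' \<longleftrightarrow>
     (\<exists>k. butlast \<eta>' = rotate k (butlast \<eta>) \<or> butlast \<eta>' = rotate k (rev (butlast \<eta>)))"

text \<open>The values of the activities \<open>lam\<close> outside the self-avoiding polygons are irrelevant.\<close>

definition loop_activities :: "('d::finite vertex list \<Rightarrow> real) \<Rightarrow> bool" where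
  "loop_activities lam \<longleftrightarrow>
     (\<forall>\<eta>. self_avoiding_polygon \<eta> \<longrightarrow> 0 \<le> lam \<eta>) \<and>
     bdd_above (lam ` {\<eta>. self_avoiding_polygon \<eta>}) \<and>
     (\<forall>R \<eta>. lattice_isometry R \<and> self_avoiding_polygon \<eta> \<longrightarrow> lam (map R \<eta>) = lam \<eta>) \<and>
     (\<forall>\<eta> \<eta>'. self_avoiding_polygon \<eta> \<and> self_avoiding_polygon \<eta>' \<and> same_unrooted_polygon \<eta> \<eta>' \<longrightarrow>
        lam \<eta> = lam \<eta>')"

text \<open>
  The product over all polygons is taken over the finitely many with a nonzero exponent, all other
  factors being 1.
\<close>

definition weight :: "('d::finite vertex list \<Rightarrow> real) \<Rightarrow> real \<Rightarrow> 'd vertex list \<Rightarrow> real" where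
  "weight lam z \<omega> =
     z ^ steps \<omega> * (\<Prod>\<eta> | self_avoiding_polygon \<eta> \<and> n_L \<eta> \<omega> \<noteq> 0. lam \<eta> ^ n_L \<eta> \<omega>)"

definition loop_erased_weight ::
    "('d::finite vertex list \<Rightarrow> real) \<Rightarrow> real \<Rightarrow> 'd vertex list \<Rightarrow> ennreal" where
  "loop_erased_weight lam z \<eta> = (\<Sum>\<^sub>\<infinity>\<omega>\<in>{\<omega>. walk \<omega> \<and> LE \<omega> = \<eta>}. ennreal (weight lam z \<omega>))"

definition loop_measure ::
    "('d::finite vertex list \<Rightarrow> real) \<Rightarrow> real \<Rightarrow> 'd vertex set \<Rightarrow> ennreal" where
  "loop_measure lam z A =
     (\<Sum>\<^sub>\<infinity>x\<in>UNIV. \<Sum>\<^sub>\<infinity>\<omega>\<in>{\<omega>. walk_from_to \<omega> x x \<and> 1 \<le> steps \<omega>}.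
        of_bool (set \<omega> \<inter> A \<noteq> {}) * ennreal (weight lam z \<omega> / real (steps \<omega>)))"

text \<open>The exponential on \<open>[0, \<infinity>]\<close>, with \<open>exp \<infinity> = \<infinity>\<close>.\<close>

definition exp_ennreal :: "ennreal \<Rightarrow> ennreal" where
  "exp_ennreal t = (if t = \<infinity> then \<infinity> else ennreal (exp (enn2real t)))"

end

theory Submission
  imports Defs "HOL-Computational_Algebra.Formal_Power_Series"
begin

text \<open>
  Everything is a generating function in \<open>z\<close>, that is, a formal power series. Cutting a walk with
  loop erasure \<open>\<eta>\<close> at its last visit to the first vertex of \<open>\<eta>\<close>, and iterating, gives
  \<open>z ^ steps \<eta>\<close> times the product of the Green functions \<open>G (U_i) (\<eta>_i)\<close>, where \<open>U_i\<close> is the lattice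
  without the earlier vertices of \<open>\<eta>\<close> and \<open>G U x\<close> counts closed walks at \<open>x\<close> in \<open>U\<close>. It remains to
  see that \<open>X G' = G W\<close>, where \<open>W U x\<close> counts the closed walks in \<open>U\<close> of positive length that pass
  through \<open>x\<close>, with an arbitrary starting vertex: integrating gives the exponential of the loop
  measure.

  Reversing or rotating a closed walk does not preserve its weight, so the last identity is not a
  bijection between walks. For finite \<open>U\<close>, let \<open>Z U\<close> be the signed generating function of sets of
  disjoint cycles in \<open>U\<close>. Decomposing a closed walk by its last loop gives \<open>G U x = Z (U - {x}) / Z U\<close>
  by induction on \<open>U\<close>, and differentiating \<open>Z\<close> amounts to marking a vertex of a cycle, so that
  \<open>- X Z' / Z\<close> is the sum over \<open>y \<in> U\<close> of \<open>G U y - 1\<close>. Here the rotation invariance of the activities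
  enters. Finally, each coefficient of the identity for \<open>G\<close> only involves finitely many vertices, so
  it holds for infinite \<open>U\<close>.
\<close>

section \<open>Sums in the extended non-negative reals\<close>

lemma ennreal_summable_on [simp]: "(f :: 'a \<Rightarrow> ennreal) summable_on A"
  by (rule nonneg_summable_on_complete) simp

lemma infsum_eq_SUP_ennreal:
  fixes f :: "'a \<Rightarrow> ennreal"
  shows "infsum f A = (SUP F\<in>{F. finite F \<and> F \<subseteq> A}. sum f F)"
  by (rule nonneg_infsum_complete) simp

lemma infsum_mono_set_ennreal:
  fixes f :: "'a \<Rightarrow> ennreal"
  assumes "A \<subseteq> B"
  shows "infsum f A \<le> infsum f B"
  by (rule infsum_mono_neutral) (use assms in auto)

lemma infsum_Un_disjoint_ennreal:
  fixes f :: "'a \<Rightarrow> ennreal"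
  assumes "A \<inter> B = {}"
  shows "infsum f (A \<union> B) = infsum f A + infsum f B"
  by (rule infsum_Un_disjoint) (use assms in auto)

lemma infsum_Sigma_finite_ennreal:
  fixes f :: "'a \<times> 'b \<Rightarrow> ennreal"
  assumes "finite X"
  shows "(\<Sum>x\<in>X. infsum (\<lambda>y. f (x, y)) (B x)) = infsum f (Sigma X B)"
  using assms
proof induction
  case empty
  then show ?case by simp
next
  case (insert x X)
  have "Sigma (insert x X) B = Pair x ` B x \<union> Sigma X B" by auto
  moreover have "Pair x ` B x \<inter> Sigma X B = {}" using insert.hyps by auto
  moreover have "infsum f (Pair x ` B x) = infsum (\<lambda>y. f (x, y)) (B x)"
    by (subst infsum_reindex) (auto simp: inj_on_def o_def)
  ultimately show ?case
    using insert by (simp add: infsum_Un_disjoint_ennreal)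
qed

text \<open>Tonelli on [0, \<infinity>]: both sides are suprema of finite sums, a finite subset of
  the Sigma set lies over finitely many \<open>x\<close>, and finitely many fibres lie inside the
  Sigma set.\<close>

lemma infsum_Sigma_ennreal:
  fixes f :: "'a \<times> 'b \<Rightarrow> ennreal"
  shows "infsum f (Sigma A B) = infsum (\<lambda>x. infsum (\<lambda>y. f (x, y)) (B x)) A"
proof (rule antisym)
  show "infsum f (Sigma A B) \<le> infsum (\<lambda>x. infsum (\<lambda>y. f (x, y)) (B x)) A"
    unfolding infsum_eq_SUP_ennreal[of f]
  proof (rule SUP_least)
    fix F assume "F \<in> {F. finite F \<and> F \<subseteq> Sigma A B}"
    then have F: "finite F" "F \<subseteq> Sigma A B" by auto
    have "sum f F = infsum f F" using F by simp
    also have "\<dots> \<le> infsum f (Sigma (fst ` F) B)"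
      using F by (intro infsum_mono_set_ennreal) force
    also have "\<dots> = (\<Sum>x\<in>fst ` F. infsum (\<lambda>y. f (x, y)) (B x))"
      using F by (simp add: infsum_Sigma_finite_ennreal)
    also have "\<dots> = infsum (\<lambda>x. infsum (\<lambda>y. f (x, y)) (B x)) (fst ` F)"
      using F by simp
    also have "\<dots> \<le> infsum (\<lambda>x. infsum (\<lambda>y. f (x, y)) (B x)) A"
      using F by (intro infsum_mono_set_ennreal) force
    finally show "sum f F \<le> infsum (\<lambda>x. infsum (\<lambda>y. f (x, y)) (B x)) A" .
  qed
next
  show "infsum (\<lambda>x. infsum (\<lambda>y. f (x, y)) (B x)) A \<le> infsum f (Sigma A B)"
    unfolding infsum_eq_SUP_ennreal[of _ A]
  proof (rule SUP_least)
    fix X assume "X \<in> {F. finite F \<and> F \<subseteq> A}"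
    then have X: "finite X" "X \<subseteq> A" by auto
    have "(\<Sum>x\<in>X. infsum (\<lambda>y. f (x, y)) (B x)) = infsum f (Sigma X B)"
      using X by (simp add: infsum_Sigma_finite_ennreal)
    also have "\<dots> \<le> infsum f (Sigma A B)"
      using X by (intro infsum_mono_set_ennreal) auto
    finally show "(\<Sum>x\<in>X. infsum (\<lambda>y. f (x, y)) (B x)) \<le> infsum f (Sigma A B)" .
  qed
qed

lemma infsum_swap_ennreal:
  fixes f :: "'a \<Rightarrow> 'b \<Rightarrow> ennreal"
  shows "infsum (\<lambda>x. infsum (f x) B) A = infsum (\<lambda>y. infsum (\<lambda>x. f x y) A) B"
proof -
  have "infsum (\<lambda>x. infsum (f x) B) A = infsum (\<lambda>(x, y). f x y) (A \<times> B)"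
    by (simp add: infsum_Sigma_ennreal)
  also have "\<dots> = infsum (\<lambda>(y, x). f x y) (B \<times> A)"
    by (rule infsum_reindex_bij_witness[of _ prod.swap prod.swap]) auto
  also have "\<dots> = infsum (\<lambda>y. infsum (\<lambda>x. f x y) A) B"
    by (simp add: infsum_Sigma_ennreal)
  finally show ?thesis .
qed

lemma infsum_cmult_right_ennreal:
  fixes f :: "'a \<Rightarrow> ennreal"
  shows "infsum (\<lambda>x. c * f x) A = c * infsum f A"
  unfolding infsum_eq_SUP_ennreal by (simp add: SUP_mult_left_ennreal sum_distrib_left)

lemma infsum_group_ennreal:
  fixes f :: "'a \<Rightarrow> ennreal" and s :: "'a \<Rightarrow> 'b"
  shows "infsum f A = infsum (\<lambda>n. infsum f {a \<in> A. s a = n}) UNIV"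
proof -
  have "infsum (\<lambda>n. infsum f {a \<in> A. s a = n}) UNIV
      = infsum (\<lambda>(n, a). f a) (Sigma UNIV (\<lambda>n. {a \<in> A. s a = n}))"
    by (simp add: infsum_Sigma_ennreal)
  also have "\<dots> = infsum f A"
    by (rule infsum_reindex_bij_witness[of _ "\<lambda>a. (s a, a)" snd]) auto
  finally show ?thesis by (rule sym)
qed

lemma suminf_eq_infsum_ennreal:
  fixes f :: "nat \<Rightarrow> ennreal"
  shows "suminf f = infsum f UNIV"
  by (rule sums_unique[symmetric], rule has_sum_imp_sums, rule has_sum_infsum) simp

section \<open>Formal power series\<close>

text \<open>Divergence is allowed and gives \<infinity>, so no radius of convergence enters. Since
  \<open>ennreal\<close> sends negative reals to 0, the value is meaningful when all terms are
  nonnegative.\<close>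

definition fps_eval_ennreal :: "real \<Rightarrow> real fps \<Rightarrow> ennreal" where
  "fps_eval_ennreal z f = (\<Sum>\<^sub>\<infinity>n. ennreal (fps_nth f n * z ^ n))"

definition fps_nonneg :: "real fps \<Rightarrow> bool" where
  "fps_nonneg f \<longleftrightarrow> (\<forall>n. 0 \<le> fps_nth f n)"

lemma fps_nonneg_mult: "fps_nonneg f \<Longrightarrow> fps_nonneg g \<Longrightarrow> fps_nonneg (f * g)"
  by (auto simp: fps_nonneg_def fps_mult_nth intro!: sum_nonneg)

lemma fps_nonneg_power: "fps_nonneg f \<Longrightarrow> fps_nonneg (f ^ k)"
  by (induction k) (auto simp: fps_nonneg_mult, auto simp: fps_nonneg_def)

lemma fps_eval_ennreal_mult:
  assumes "0 \<le> z" "fps_nonneg f" "fps_nonneg g"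
  shows "fps_eval_ennreal z (f * g) = fps_eval_ennreal z f * fps_eval_ennreal z g"
proof -
  let ?a = "\<lambda>n. ennreal (fps_nth f n * z ^ n)" and ?b = "\<lambda>n. ennreal (fps_nth g n * z ^ n)"
  have nn: "0 \<le> fps_nth f n * z ^ n" "0 \<le> fps_nth g n * z ^ n" for n
    using assms by (auto simp: fps_nonneg_def)
  have "ennreal (fps_nth (f * g) n * z ^ n) = infsum (\<lambda>i. ?a i * ?b (n - i)) {0..n}" for n
  proof -
    have "fps_nth (f * g) n * z ^ n
        = (\<Sum>i=0..n. (fps_nth f i * z ^ i) * (fps_nth g (n - i) * z ^ (n - i)))"
      unfolding fps_mult_nth sum_distrib_right
    proof (rule sum.cong[OF refl])
      fix i assume "i \<in> {0..n}"
      then have "z ^ n = z ^ i * z ^ (n - i)" by (simp add: power_add[symmetric])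
      then show "fps_nth f i * fps_nth g (n - i) * z ^ n
          = fps_nth f i * z ^ i * (fps_nth g (n - i) * z ^ (n - i))" by simp
    qed
    also have "ennreal \<dots> = (\<Sum>i=0..n. ?a i * ?b (n - i))"
      using nn by (simp add: sum_ennreal[symmetric] ennreal_mult)
    finally show ?thesis by simp
  qed
  then have "fps_eval_ennreal z (f * g)
      = infsum (\<lambda>(n, i). ?a i * ?b (n - i)) (Sigma UNIV (\<lambda>n. {0..n}))"
    by (simp add: fps_eval_ennreal_def infsum_Sigma_ennreal)
  \<comment> \<open>The triangle \<open>i \<le> n\<close> becomes the quadrant of pairs
    \<open>(i, j)\<close> with \<open>j = n - i\<close>; on the triangle the truncated subtraction
    is exact.\<close>
  also have "\<dots> = infsum (\<lambda>(i, j). ?a i * ?b j) (UNIV \<times> UNIV)"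
    by (rule infsum_reindex_bij_witness[of _ "\<lambda>(i, j). (i + j, i)" "\<lambda>(n, i). (i, n - i)"]) auto
  also have "\<dots> = infsum (\<lambda>i. infsum (\<lambda>j. ?a i * ?b j) UNIV) UNIV"
    by (subst infsum_Sigma_ennreal) simp
  also have "\<dots> = infsum (\<lambda>i. fps_eval_ennreal z g * ?a i) UNIV"
    by (simp add: infsum_cmult_right_ennreal fps_eval_ennreal_def mult.commute)
  also have "\<dots> = fps_eval_ennreal z f * fps_eval_ennreal z g"
    by (simp add: infsum_cmult_right_ennreal mult.commute, simp add: fps_eval_ennreal_def mult.commute)
  finally show ?thesis .
qed

lemma fps_eval_ennreal_1 [simp]: "fps_eval_ennreal z 1 = 1"
proof -
  have "fps_eval_ennreal z 1 = infsum (\<lambda>n. ennreal (fps_nth 1 n * z ^ n)) {0::nat}"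
    unfolding fps_eval_ennreal_def by (rule infsum_cong_neutral) auto
  then show ?thesis by simp
qed

lemma fps_eval_ennreal_power:
  assumes "0 \<le> z" "fps_nonneg f"
  shows "fps_eval_ennreal z (f ^ k) = fps_eval_ennreal z f ^ k"
  using assms by (induction k) (simp_all add: fps_eval_ennreal_mult fps_nonneg_power)

lemma fps_eval_ennreal_fps_X_power_mult:
  assumes "0 \<le> z" "fps_nonneg f"
  shows "fps_eval_ennreal z (fps_X ^ k * f) = ennreal (z ^ k) * fps_eval_ennreal z f"
proof -
  have "fps_eval_ennreal z (fps_X ^ k) = infsum (\<lambda>n. ennreal (fps_nth (fps_X ^ k) n * z ^ n)) {k}"
    unfolding fps_eval_ennreal_def by (rule infsum_cong_neutral) auto
  moreover have "fps_nonneg (fps_X ^ k)" by (simp add: fps_nonneg_def)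
  ultimately show ?thesis using assms by (simp add: fps_eval_ennreal_mult)
qed

lemma exp_ennreal_eq_suminf: "exp_ennreal t = (\<Sum>k. t ^ k / fact k)"
proof (cases "t = top")
  case True
  \<comment> \<open>The term of index 1 is \<open>t\<close> itself, so it alone makes the series
    infinite.\<close>
  have "(t ^ 1 / fact 1 :: ennreal) \<le> (\<Sum>k. t ^ k / fact k)"
    using sum_le_suminf[of "\<lambda>k. t ^ k / fact k :: ennreal" "{1}"] by simp
  then have "(\<Sum>k. t ^ k / fact k) = top" using True by (simp add: top_unique divide_ennreal_def)
  then show ?thesis using True by (simp add: exp_ennreal_def)
next
  case False
  then obtain r where r: "0 \<le> r" "t = ennreal r" by (cases t) auto
  have "(t ^ k / fact k :: ennreal) = ennreal (r ^ k / fact k)" for k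
    using r by (simp add: ennreal_power divide_ennreal[symmetric])
       (metis ennreal_of_nat_eq_real_of_nat of_nat_fact)
  then have "(\<Sum>k. t ^ k / fact k) = (\<Sum>k. ennreal (r ^ k / fact k))" by simp
  also have "\<dots> = ennreal (\<Sum>k. r ^ k / fact k)"
    using summable_exp[of r] r by (intro suminf_ennreal2) (simp_all add: field_simps)
  also have "(\<Sum>k. r ^ k / fact k) = exp r"
    by (simp add: exp_def field_simps)
  finally show ?thesis using r False by (simp add: exp_ennreal_def)
qed

lemma fps_nth_power_eq_0: "fps_nth f 0 = (0::'a::idom) \<Longrightarrow> n < k \<Longrightarrow> fps_nth (f ^ k) n = 0"
  using startsby_zero_power_prefix by blast

text \<open>\<open>f\<close> has no constant term, so \<open>f ^ k\<close> starts at degree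
  \<open>k\<close> or later: the sum over \<open>k \<le> n\<close> in a coefficient of the
  composition extends to all \<open>k\<close>, and Tonelli then exchanges the sums over
  \<open>n\<close> and \<open>k\<close>.\<close>

lemma fps_eval_ennreal_exp:
  assumes z: "0 \<le> z" and f: "fps_nonneg f" "fps_nth f 0 = 0"
  shows "fps_eval_ennreal z (fps_exp 1 oo f) = exp_ennreal (fps_eval_ennreal z f)"
proof -
  have nn: "0 \<le> fps_nth (f ^ k) n * z ^ n" for n k
    using fps_nonneg_power[OF f(1)] z by (simp add: fps_nonneg_def)
  have "ennreal (fps_nth (fps_exp 1 oo f) n * z ^ n)
      = infsum (\<lambda>k. ennreal (fps_nth (f ^ k) n * z ^ n) / fact k) UNIV" for n
  proof -
    have "ennreal (fps_nth (fps_exp 1 oo f) n * z ^ n)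
        = (\<Sum>k=0..n. ennreal (fps_nth (f ^ k) n * z ^ n / fact k))"
      using nn by (subst sum_ennreal) (auto simp: fps_compose_nth sum_distrib_left field_simps)
    also have "\<dots> = (\<Sum>k=0..n. ennreal (fps_nth (f ^ k) n * z ^ n) / fact k)"
      using nn by (intro sum.cong) (simp_all add: divide_ennreal[symmetric],
        metis ennreal_of_nat_eq_real_of_nat of_nat_fact)
    also have "\<dots> = infsum (\<lambda>k. ennreal (fps_nth (f ^ k) n * z ^ n) / fact k) {0..n}"
      by simp
    also have "\<dots> = infsum (\<lambda>k. ennreal (fps_nth (f ^ k) n * z ^ n) / fact k) UNIV"
      by (rule infsum_cong_neutral) (auto simp: fps_nth_power_eq_0 f)
    finally show ?thesis .
  qed
  then have "fps_eval_ennreal z (fps_exp 1 oo f)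
      = infsum (\<lambda>k. infsum (\<lambda>n. ennreal (fps_nth (f ^ k) n * z ^ n) / fact k) UNIV) UNIV"
    by (simp add: fps_eval_ennreal_def infsum_swap_ennreal[of "\<lambda>n k. ennreal (fps_nth (f ^ k) n * z ^ n) / fact k"])
  also have "\<dots> = infsum (\<lambda>k. fps_eval_ennreal z (f ^ k) / fact k) UNIV"
    by (simp add: divide_ennreal_def fps_eval_ennreal_def mult.commute infsum_cmult_right_ennreal)
  also have "\<dots> = exp_ennreal (fps_eval_ennreal z f)"
    by (simp add: exp_ennreal_eq_suminf fps_eval_ennreal_power z f suminf_eq_infsum_ennreal)
  finally show ?thesis .
qed

text \<open>Integrating factor: for every solution \<open>h\<close> with constant term 1, the
  product of \<open>h\<close> with the exponential of \<open>- g\<close> has zero derivative, so it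
  is 1. Both \<open>f\<close> and the exponential of \<open>g\<close> are such solutions, and
  inverses are unique.\<close>

lemma fps_deriv_eq_mult_imp_eq_exp:
  fixes f g :: "real fps"
  assumes "fps_deriv f = f * fps_deriv g" "fps_nth f 0 = 1" "fps_nth g 0 = 0"
  shows "f = fps_exp 1 oo g"
proof -
  define E where "E c = fps_exp c oo g" for c :: real
  have dE: "fps_deriv (E c) = fps_const c * E c * fps_deriv g" for c
    using assms(3) by (simp add: E_def fps_compose_deriv fps_compose_mult_distrib)
  have *: "h * E (-1) = 1" if "fps_deriv h = h * fps_deriv g" "fps_nth h 0 = 1" for h
  proof -
    have "fps_deriv (h * E (-1)) = 0"
    proof -
      have "fps_deriv (E (-1)) = fps_const (-1) * E (-1) * fps_deriv g" by (rule dE)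
      also have "fps_const (-1 :: real) = -1" by (metis fps_const_1_eq_1 fps_const_neg)
      finally have "fps_deriv (E (-1)) = - E (-1) * fps_deriv g" by simp
      then show ?thesis using that by (simp add: algebra_simps)
    qed
    then have "h * E (-1) = fps_const (fps_nth (h * E (-1)) 0)"
      by (simp only: fps_deriv_eq_0_iff)
    also have "fps_nth (h * E (-1)) 0 = 1" using that by (simp add: E_def)
    finally show ?thesis by simp
  qed
  have "f * E (-1) = 1" "E 1 * E (-1) = 1"
    using assms dE[of 1] by (intro *; simp add: E_def)+
  then have "f = f * (E 1 * E (-1))" by simp
  also have "\<dots> = f * E (-1) * E 1" by (simp add: mult_ac)
  also have "\<dots> = E 1" using \<open>f * E (-1) = 1\<close> by simp
  finally have "f = E 1" .
  then show ?thesis by (simp add: E_def)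
qed

section \<open>The Euler operator X d/dX\<close>

lemma fps_XD_nth [simp]: "fps_nth (fps_XD (f :: 'a::comm_ring_1 fps)) n = of_nat n * fps_nth f n"
  using fps_mult_fps_XD_shift[of 1 f] by simp

lemma fps_XD_mult: "fps_XD (f * g) = fps_XD f * g + f * fps_XD (g :: 'a::comm_ring_1 fps)"
  by (simp add: fps_XD_def algebra_simps)

lemma fps_XD_minus: "fps_XD (f - g) = fps_XD f - fps_XD (g :: 'a::comm_ring_1 fps)"
  by (simp add: fps_XD_def algebra_simps)

lemma fps_XD_sum: "fps_XD (sum f A) = (\<Sum>a\<in>A. fps_XD (f a :: 'a::comm_ring_1 fps))"
  by (induction A rule: infinite_finite_induct) (auto simp: fps_XD_def algebra_simps)

lemma fps_XD_X_power: "fps_XD (fps_X ^ k) = of_nat k * (fps_X ^ k :: 'a::comm_ring_1 fps)"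
  by (rule fps_ext) (simp add: fps_of_nat[symmetric] del: fps_of_nat)

lemma fps_XD_const: "fps_XD (fps_const (c :: 'a::comm_ring_1)) = 0"
  by (rule fps_ext) simp

lemma fps_XD_eq_0_imp_eq_0:
  fixes f :: "real fps"
  assumes "fps_XD f = 0" "fps_nth f 0 = 0"
  shows "f = 0"
proof (rule fps_ext)
  fix n
  have "of_nat n * fps_nth f n = 0" using assms(1) by (metis fps_XD_nth fps_zero_nth)
  then show "fps_nth f n = fps_nth 0 n" using assms(2) by (cases n) auto
qed

section \<open>Generating functions\<close>

definition genfun :: "('a \<Rightarrow> nat) \<Rightarrow> ('a \<Rightarrow> real) \<Rightarrow> 'a set \<Rightarrow> real fps" where
  "genfun s w A = Abs_fps (\<lambda>n. \<Sum>a | a \<in> A \<and> s a = n. w a)"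

text \<open>\<open>genfun\<close> sums over sets of elements of equal size, and a sum over an
  infinite set is 0 by convention; this condition ensures that the coefficients are genuine.\<close>

definition graded :: "('a \<Rightarrow> nat) \<Rightarrow> 'a set \<Rightarrow> bool" where
  "graded s A \<longleftrightarrow> (\<forall>n. finite {a \<in> A. s a = n})"

lemma genfun_nth: "fps_nth (genfun s w A) n = (\<Sum>a | a \<in> A \<and> s a = n. w a)"
  by (simp add: genfun_def)

lemma graded_subset: "graded s B \<Longrightarrow> A \<subseteq> B \<Longrightarrow> graded s A"
  unfolding graded_def by (auto elim!: finite_subset[rotated])

lemma genfun_empty [simp]: "genfun s w {} = 0"
  by (simp add: genfun_def fps_eq_iff)

lemma genfun_reindex:
  assumes "bij_betw f A B" "\<And>a. a \<in> A \<Longrightarrow> s (f a) = t a" "\<And>a. a \<in> A \<Longrightarrow> w (f a) = v a"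
  shows "genfun s w B = genfun t v A"
proof (rule fps_ext)
  fix n
  have "bij_betw f {a \<in> A. t a = n} {b \<in> B. s b = n}"
    by (rule bij_betw_subset[OF assms(1)])
      (use assms in \<open>auto simp: bij_betw_def\<close>)
  then show "fps_nth (genfun s w B) n = fps_nth (genfun t v A) n"
    unfolding genfun_nth using assms(3)
    by (subst sum.reindex_bij_betw[symmetric, of f]) auto
qed

lemma genfun_Un:
  assumes "graded s A" "graded s B" "A \<inter> B = {}"
  shows "genfun s w (A \<union> B) = genfun s w A + genfun s w B"
proof (rule fps_ext)
  fix n
  have "{a \<in> A \<union> B. s a = n} = {a \<in> A. s a = n} \<union> {a \<in> B. s a = n}" by auto
  then show "fps_nth (genfun s w (A \<union> B)) n = fps_nth (genfun s w A + genfun s w B) n"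
    using assms by (simp add: genfun_nth graded_def, subst sum.union_disjoint) auto
qed

lemma genfun_group:
  assumes "graded s A" "finite I" "p ` A \<subseteq> I"
  shows "genfun s w A = (\<Sum>i\<in>I. genfun s w {a \<in> A. p a = i})"
proof (rule fps_ext)
  fix n
  have "(\<Sum>a | a \<in> A \<and> s a = n. w a) = (\<Sum>i\<in>I. \<Sum>a | a \<in> {a \<in> A. s a = n} \<and> p a = i. w a)"
    using assms by (subst sum.group) (auto simp: graded_def)
  also have "\<dots> = (\<Sum>i\<in>I. \<Sum>a | a \<in> {a \<in> A. p a = i} \<and> s a = n. w a)"
    by (intro sum.cong) auto
  finally show "fps_nth (genfun s w A) n = fps_nth (\<Sum>i\<in>I. genfun s w {a \<in> A. p a = i}) n"
    by (simp add: genfun_nth fps_sum_nth)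
qed

lemma genfun_fps_const_mult:
  assumes "\<And>a. a \<in> A \<Longrightarrow> w a = c * v a"
  shows "genfun s w A = fps_const c * genfun s v A"
  using assms by (intro fps_ext) (simp add: genfun_nth sum_distrib_left)

lemma genfun_fps_X_power_mult:
  assumes "\<And>a. a \<in> A \<Longrightarrow> s a = t a + k"
  shows "genfun s w A = fps_X ^ k * genfun t w A"
proof (rule fps_ext)
  fix n
  show "fps_nth (genfun s w A) n = fps_nth (fps_X ^ k * genfun t w A) n"
  proof (cases "n < k")
    case True
    then have "{a \<in> A. s a = n} = {}" using assms by auto
    then show ?thesis using True by (simp add: genfun_nth fps_X_power_mult_nth del: Collect_empty_eq)
  next
    case False
    then have "{a \<in> A. s a = n} = {a \<in> A. t a = n - k}" using assms by auto
    then show ?thesis using False by (simp add: genfun_nth fps_X_power_mult_nth)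
  qed
qed

lemma genfun_times:
  assumes "graded s A" "graded t B"
  shows "genfun (\<lambda>(a, b). s a + t b) (\<lambda>(a, b). w a * v b) (A \<times> B) = genfun s w A * genfun t v B"
proof (rule fps_ext)
  fix n
  let ?A = "\<lambda>i. {a \<in> A. s a = i}" and ?B = "\<lambda>i. {b \<in> B. t b = i}"
  have fin: "finite (?A i)" "finite (?B i)" for i using assms by (auto simp: graded_def)
  have *: "{x \<in> A \<times> B. (case x of (a, b) \<Rightarrow> s a + t b) = n} = (\<Union>i\<in>{0..n}. ?A i \<times> ?B (n - i))"
    by auto
  have "fps_nth (genfun (\<lambda>(a, b). s a + t b) (\<lambda>(a, b). w a * v b) (A \<times> B)) n
      = (\<Sum>x\<in>(\<Union>i\<in>{0..n}. ?A i \<times> ?B (n - i)). case x of (a, b) \<Rightarrow> w a * v b)"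
    by (simp only: genfun_nth *)
  also have "\<dots> = (\<Sum>i\<in>{0..n}. \<Sum>x\<in>?A i \<times> ?B (n - i). case x of (a, b) \<Rightarrow> w a * v b)"
    by (rule sum.UNION_disjoint) (use fin in auto)
  also have "\<dots> = (\<Sum>i\<in>{0..n}. sum w (?A i) * sum v (?B (n - i)))"
    by (simp add: sum.cartesian_product[symmetric] sum_product)
  also have "\<dots> = fps_nth (genfun s w A * genfun t v B) n"
    by (simp add: genfun_nth fps_mult_nth)
  finally show "fps_nth (genfun (\<lambda>(a, b). s a + t b) (\<lambda>(a, b). w a * v b) (A \<times> B)) n
      = fps_nth (genfun s w A * genfun t v B) n" .
qed

lemma fps_nonneg_genfun: "(\<And>a. a \<in> A \<Longrightarrow> 0 \<le> w a) \<Longrightarrow> fps_nonneg (genfun s w A)"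
  by (auto simp: fps_nonneg_def genfun_nth intro!: sum_nonneg)

lemma fps_eval_ennreal_genfun:
  assumes "graded s A" "0 \<le> z" "\<And>a. a \<in> A \<Longrightarrow> 0 \<le> w a"
  shows "fps_eval_ennreal z (genfun s w A) = (\<Sum>\<^sub>\<infinity>a\<in>A. ennreal (w a * z ^ s a))"
proof -
  have "ennreal (fps_nth (genfun s w A) n * z ^ n)
      = (\<Sum>\<^sub>\<infinity>a\<in>{a \<in> A. s a = n}. ennreal (w a * z ^ s a))" for n
  proof -
    have fin: "finite {a \<in> A. s a = n}" using assms by (simp add: graded_def)
    have "ennreal (fps_nth (genfun s w A) n * z ^ n)
        = ennreal (\<Sum>a | a \<in> A \<and> s a = n. w a * z ^ s a)"
      by (simp add: genfun_nth sum_distrib_right)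
    also have "\<dots> = (\<Sum>a | a \<in> A \<and> s a = n. ennreal (w a * z ^ s a))"
      using assms by (subst sum_ennreal) auto
    finally show ?thesis using fin by simp
  qed
  then show ?thesis
    unfolding fps_eval_ennreal_def by (subst infsum_group_ennreal[of _ A s]) simp
qed

section \<open>The partition function of disjoint cycles\<close>

text \<open>Cycles are oriented and rooted at their head, and the root is not repeated at the end.
  Moving the root is a rotation, so by distinctness an unrooted cycle of length \<open>n\<close>
  appears as exactly \<open>n\<close> lists.\<close>

locale cycle_weights =
  fixes Cyc :: "'a list set" and w :: "'a list \<Rightarrow> real"
  assumes Cyc_Nil: "[] \<notin> Cyc"
    and Cyc_distinct: "c \<in> Cyc \<Longrightarrow> distinct c"
    and Cyc_rotate1: "c \<in> Cyc \<Longrightarrow> rotate1 c \<in> Cyc"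
    and w_rotate1: "c \<in> Cyc \<Longrightarrow> w (rotate1 c) = w c"
begin

definition cycles :: "'a set \<Rightarrow> 'a list set" where
  "cycles U = {c \<in> Cyc. set c \<subseteq> U}"

lemma finite_cycles: "finite U \<Longrightarrow> finite (cycles U)"
  by (rule finite_subset[OF _ finite_subset_distinct[of U]]) (auto simp: cycles_def Cyc_distinct)

lemma cyclesD: "c \<in> cycles U \<Longrightarrow> c \<noteq> []" "c \<in> cycles U \<Longrightarrow> set c \<subseteq> U" "c \<in> cycles U \<Longrightarrow> distinct c"
  "c \<in> cycles U \<Longrightarrow> c \<in> Cyc"
  using Cyc_Nil by (auto simp: cycles_def Cyc_distinct)

lemma card_Diff_cycle: "finite U \<Longrightarrow> c \<in> cycles U \<Longrightarrow> card (U - set c) < card U"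
  by (rule psubset_card_mono) (use cyclesD[of c U] in \<open>auto simp: neq_Nil_conv\<close>)

lemma rotate_Cyc: "c \<in> Cyc \<Longrightarrow> rotate k c \<in> Cyc \<and> w (rotate k c) = w c"
  by (induction k) (auto simp: Cyc_rotate1 w_rotate1)

text \<open>In Viennot's theory of heaps of pieces, \<open>cycle_poly U\<close> is the sum over all sets of pairwise
  disjoint unrooted cycles in \<open>U\<close> of the product of the factors \<open>- w c * X ^ length c\<close>. Defining it
  by the differential equation that this sum satisfies avoids unrooted cycles.\<close>

function cycle_poly :: "'a set \<Rightarrow> real fps" where
  "cycle_poly U = (if finite U then 1 - Abs_fps (\<lambda>n. fps_nth
     (\<Sum>c\<in>cycles U. fps_const (w c) * fps_X ^ length c * cycle_poly (U - set c)) n / real n) else 1)"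
  by pat_completeness auto
termination
  by (relation "Wellfounded.measure card") (auto simp: card_Diff_cycle)

declare cycle_poly.simps [simp del]

definition cycle_term :: "'a set \<Rightarrow> 'a list \<Rightarrow> real fps" where
  "cycle_term U c = fps_const (w c) * fps_X ^ length c * cycle_poly (U - set c)"

text \<open>At index 0 the division by \<open>real n\<close> is a division by 0, with value 0, so
  only the 1 in front remains.\<close>

lemma cycle_poly_nth_0 [simp]: "fps_nth (cycle_poly U) 0 = 1"
  by (simp add: cycle_poly.simps[of U])

lemma cycle_poly_neq_0 [simp]: "cycle_poly U \<noteq> 0"
  by (metis cycle_poly_nth_0 fps_zero_nth zero_neq_one)

lemma cycle_term_nth_0: "c \<in> cycles U \<Longrightarrow> fps_nth (cycle_term V c) 0 = 0"
  using cyclesD(1)[of c U] by (simp add: cycle_term_def fps_mult_nth_0)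

text \<open>The Euler operator multiplies a set of disjoint cycles by its total length, the number
  of ways to root one of its cycles; the minus sign is the sign of the rooted cycle. As
  \<open>cycle_poly\<close> is defined by this equation, only index 0 needs an argument: cycles are
  nonempty.\<close>

lemma fps_XD_cycle_poly:
  assumes "finite U"
  shows "fps_XD (cycle_poly U) = - (\<Sum>c\<in>cycles U. cycle_term U c)"
proof (rule fps_ext)
  fix n
  show "fps_nth (fps_XD (cycle_poly U)) n = fps_nth (- (\<Sum>c\<in>cycles U. cycle_term U c)) n"
  proof (cases "n = 0")
    case True
    then show ?thesis by (simp add: fps_sum_nth cycle_term_nth_0)
  next
    case False
    then show ?thesis using assms by (simp add: cycle_poly.simps[of U] cycle_term_def)
  qed
qed

text \<open>Each cycle through \<open>x\<close> is a rotation of exactly one cycle rooted at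
  \<open>x\<close>, and the rotations of such a cycle \<open>c\<close> by 0 up to
  \<open>length c - 1\<close> are pairwise different.\<close>

lemma sum_cycles_through:
  assumes "finite U" and rot: "\<And>c k. c \<in> cycles U \<Longrightarrow> f (rotate k c) = (f c :: 'b::comm_semiring_1)"
  shows "(\<Sum>c | c \<in> cycles U \<and> x \<in> set c. f c) = (\<Sum>c | c \<in> cycles U \<and> hd c = x. of_nat (length c) * f c)"
proof -
  let ?A = "SIGMA c:{c \<in> cycles U. hd c = x}. {..<length c}"
  have fin: "finite {c \<in> cycles U. hd c = x}" using finite_cycles[OF assms(1)] by simp
  have "bij_betw (\<lambda>(c, k). rotate k c) ?A {c \<in> cycles U. x \<in> set c}"
  proof (rule bij_betw_imageI)
    show "inj_on (\<lambda>(c, k). rotate k c) ?A"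
    proof (rule inj_onI, clarify)
      fix c k c' k'
      assume c: "c \<in> cycles U" "k < length c" "c' \<in> cycles U" "k' < length c'"
        and hd: "hd c' = hd c" and eq: "rotate k c = rotate k' c'"
      have len: "length c' = length c" using eq by (metis length_rotate)
      have dist: "distinct (rotate k c)" using c cyclesD by simp
      \<comment> \<open>The position of the old root after \<open>j\<close> rotations. In a list
        without repetitions the common root has a single position, which recovers
        \<open>j\<close>.\<close>
      have nth: "rotate j d ! ((length d - j) mod length d) = hd d" if "d \<noteq> []" "j < length d" for j and d :: "'a list"
        using that by (simp add: nth_rotate hd_conv_nth mod_simps)
      have "rotate k c ! ((length c - k) mod length c) = rotate k c ! ((length c - k') mod length c)"
        using nth[of c k] nth[of c' k'] c hd eq len cyclesD(1) by auto
      moreover have "(length c - k) mod length c < length (rotate k c)" "(length c - k') mod length c < length (rotate k c)"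
        using c(2) by (simp_all add: mod_less_divisor[OF order.strict_trans1[OF le0]])
      ultimately have "(length c - k) mod length c = (length c - k') mod length c"
        using dist by (metis nth_eq_iff_index_eq)
      then have "k = k'"
        using c(2,4) len by (cases "k = 0"; cases "k' = 0") auto
      moreover have "rotate (length d - j) (rotate j d) = d" if "j < length d" for j and d :: "'a list"
        using that by (simp add: rotate_rotate)
      ultimately have "c = c'" using eq len c by metis
      then show "c = c' \<and> k = k'" using \<open>k = k'\<close> by simp
    qed
    show "(\<lambda>(c, k). rotate k c) ` ?A = {c \<in> cycles U. x \<in> set c}"
    proof (intro equalityI subsetI)
      fix d assume "d \<in> (\<lambda>(c, k). rotate k c) ` ?A"
      then show "d \<in> {c \<in> cycles U. x \<in> set c}"
        using cyclesD(1) by (auto simp: cycles_def rotate_Cyc)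
    next
      fix d assume "d \<in> {c \<in> cycles U. x \<in> set c}"
      then have d: "d \<in> cycles U" "x \<in> set d" by auto
      then obtain i where i: "i < length d" "d ! i = x" by (auto simp: in_set_conv_nth)
      let ?c = "rotate i d" and ?k = "(length d - i) mod length d"
      have "?c \<in> cycles U" using d by (auto simp: cycles_def rotate_Cyc)
      moreover have "hd ?c = x" using i by (subst hd_rotate_conv_nth) auto
      moreover have "rotate ?k ?c = d"
      proof -
        have "rotate ?k ?c = rotate (length d - i) ?c" by (metis length_rotate rotate_conv_mod)
        also have "\<dots> = rotate (length d) d" using i by (simp add: rotate_rotate)
        finally show ?thesis by simp
      qed
      moreover have "?k < length ?c" using i by (auto intro!: mod_less_divisor)
      ultimately show "d \<in> (\<lambda>(c, k). rotate k c) ` ?A" by (intro image_eqI[of _ _ "(?c, ?k)"]) auto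
    qed
  qed
  then have "(\<Sum>c | c \<in> cycles U \<and> x \<in> set c. f c) = (\<Sum>(c, k)\<in>?A. f (rotate k c))"
    by (subst sum.reindex_bij_betw[symmetric]) (simp_all add: case_prod_unfold)
  also have "\<dots> = (\<Sum>c | c \<in> cycles U \<and> hd c = x. \<Sum>k<length c. f (rotate k c))"
    using fin by (subst sum.Sigma) auto
  also have "\<dots> = (\<Sum>c | c \<in> cycles U \<and> hd c = x. of_nat (length c) * f c)"
    by (intro sum.cong) (auto simp: rot)
  finally show ?thesis .
qed

text \<open>A set of disjoint cycles has at most one cycle through \<open>x\<close>; rooting it at
  \<open>x\<close> and splitting it off gives the sum, up to sign. With \<open>cycle_poly\<close>
  given by a differential equation, the proof shows instead, by induction on the size of
  \<open>U\<close>, that both sides have the same Euler derivative and the same constant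
  term.\<close>

lemma cycle_poly_root:
  assumes "finite U" "x \<in> U"
  shows "cycle_poly (U - {x}) - cycle_poly U = (\<Sum>c | c \<in> cycles U \<and> hd c = x. cycle_term U c)"
  using assms
proof (induction "card U" arbitrary: U rule: less_induct)
  case less
  note fin = less.prems(1) and x = less.prems(2)
  let ?R = "\<lambda>U. {c \<in> cycles U. hd c = x}"
  let ?m = "\<lambda>c. fps_const (w c) * fps_X ^ length c"
  let ?m2 = "\<lambda>c d. ?m c * ?m d * cycle_poly (U - set c - set d)"
  have finC: "finite (cycles V)" "finite (?R V)" if "V \<subseteq> U" for V
    using finite_cycles[OF finite_subset[OF that fin]] by auto
  have split: "cycles U = {c \<in> cycles U. x \<in> set c} \<union> cycles (U - {x})"
    "{c \<in> cycles U. x \<in> set c} \<inter> cycles (U - {x}) = {}" by (auto simp: cycles_def)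
  \<comment> \<open>Moving the root of a cycle through \<open>x\<close> to \<open>x\<close> costs
    the factor \<open>length c\<close>, which the Euler operator produces as well in
    \<open>XD_term\<close>.\<close>
  have through: "(\<Sum>c | c \<in> cycles U \<and> x \<in> set c. cycle_term U c)
      = (\<Sum>c\<in>?R U. of_nat (length c) * cycle_term U c)"
    using fin by (intro sum_cycles_through) (auto simp: cycle_term_def rotate_Cyc cyclesD)
  \<comment> \<open>The induction hypothesis applies to \<open>U - set c\<close>, which is smaller
    and still contains \<open>x\<close>.\<close>
  have avoid: "cycle_term U c - cycle_term (U - {x}) c = - (\<Sum>d\<in>?R (U - set c). ?m2 c d)"
    if c: "c \<in> cycles (U - {x})" for c
  proof -
    have cU: "c \<in> cycles U" using c by (auto simp: cycles_def)
    have "x \<in> U - set c" using x cyclesD(2)[OF c] by auto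
    then have "cycle_poly (U - set c - {x}) - cycle_poly (U - set c) = (\<Sum>d\<in>?R (U - set c). cycle_term (U - set c) d)"
      using less.hyps[of "U - set c"] card_Diff_cycle[OF fin cU] fin by simp
    moreover have "U - {x} - set c = U - set c - {x}" by auto
    ultimately have "cycle_term U c - cycle_term (U - {x}) c
        = - (?m c * (\<Sum>d\<in>?R (U - set c). cycle_term (U - set c) d))"
      by (simp add: cycle_term_def algebra_simps)
    then show ?thesis by (simp add: cycle_term_def sum_distrib_left mult.assoc)
  qed
  have XD_term: "fps_XD (cycle_term U d) = of_nat (length d) * cycle_term U d - (\<Sum>c\<in>cycles (U - set d). ?m2 c d)"
    for d
  proof -
    have "fps_XD (cycle_term U d) = of_nat (length d) * cycle_term U d + ?m d * fps_XD (cycle_poly (U - set d))"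
      by (simp add: cycle_term_def fps_XD_mult fps_XD_X_power fps_XD_const mult.assoc algebra_simps)
    also have "?m d * fps_XD (cycle_poly (U - set d)) = - (\<Sum>c\<in>cycles (U - set d). ?m2 c d)"
      using fin by (simp add: fps_XD_cycle_poly cycle_term_def sum_distrib_left mult_ac Diff_eq Int_ac)
    finally show ?thesis by simp
  qed
  \<comment> \<open>Both sides run over the pairs of disjoint cycles in \<open>U\<close> in which
    \<open>d\<close> is rooted at \<open>x\<close>; disjointness already forces \<open>c\<close> to
    avoid \<open>x\<close>.\<close>
  have swap: "(\<Sum>c\<in>cycles (U - {x}). \<Sum>d\<in>?R (U - set c). ?m2 c d) = (\<Sum>d\<in>?R U. \<Sum>c\<in>cycles (U - set d). ?m2 c d)"
  proof -
    have "(\<Sum>c\<in>cycles (U - {x}). \<Sum>d\<in>?R (U - set c). ?m2 c d)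
        = (\<Sum>(c, d)\<in>(SIGMA c:cycles (U - {x}). ?R (U - set c)). ?m2 c d)"
      using finC by (subst sum.Sigma) auto
    also have "\<dots> = (\<Sum>(d, c)\<in>(SIGMA d:?R U. cycles (U - set d)). ?m2 c d)"
    proof (rule sum.reindex_bij_witness[of _ prod.swap prod.swap], goal_cases)
      case (2 a)
      then show ?case using cyclesD(1) by (auto simp: cycles_def)
    next
      case (4 b)
      then obtain d c where b: "b = (d, c)" "d \<in> cycles U" "hd d = x" "c \<in> cycles (U - set d)" by auto
      then have "x \<in> set d" "set d \<subseteq> U" "set c \<subseteq> U - set d" using cyclesD by auto
      then have "set c \<subseteq> U - {x}" "set d \<subseteq> U - set c" by auto
      then show ?case using b by (simp add: cycles_def)
    qed auto
    also have "\<dots> = (\<Sum>d\<in>?R U. \<Sum>c\<in>cycles (U - set d). ?m2 c d)"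
      using finC by (subst sum.Sigma) auto
    finally show ?thesis .
  qed
  let ?E = "cycle_poly (U - {x}) - cycle_poly U - (\<Sum>c\<in>?R U. cycle_term U c)"
  have "fps_XD ?E = (\<Sum>c\<in>cycles U. cycle_term U c) - (\<Sum>c\<in>cycles (U - {x}). cycle_term (U - {x}) c)
      - (\<Sum>c\<in>?R U. fps_XD (cycle_term U c))"
    using fin by (simp add: fps_XD_minus fps_XD_sum fps_XD_cycle_poly)
  also have "(\<Sum>c\<in>cycles U. cycle_term U c)
      = (\<Sum>c\<in>?R U. of_nat (length c) * cycle_term U c) + (\<Sum>c\<in>cycles (U - {x}). cycle_term U c)"
    unfolding through[symmetric] by (subst split(1), subst sum.union_disjoint) (use finC split(2) in auto)
  also have "(\<Sum>c\<in>?R U. fps_XD (cycle_term U c))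
      = (\<Sum>c\<in>?R U. of_nat (length c) * cycle_term U c) - (\<Sum>d\<in>?R U. \<Sum>c\<in>cycles (U - set d). ?m2 c d)"
    by (simp only: XD_term sum_subtractf)
  finally have "fps_XD ?E = (\<Sum>c\<in>cycles (U - {x}). cycle_term U c - cycle_term (U - {x}) c)
      + (\<Sum>d\<in>?R U. \<Sum>c\<in>cycles (U - set d). ?m2 c d)"
    by (simp add: sum_subtractf)
  also have "\<dots> = 0"
    unfolding swap[symmetric] by (simp add: avoid sum_negf)
  finally have "fps_XD ?E = 0" .
  moreover have "fps_nth ?E 0 = 0"
    by (auto simp: fps_sum_nth cycle_term_nth_0 intro!: sum.neutral)
  ultimately have "?E = 0" by (rule fps_XD_eq_0_imp_eq_0)
  then show ?case by simp
qed

lemma fps_XD_cycle_poly_root: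
  assumes "finite U"
  shows "fps_XD (cycle_poly U) = - (\<Sum>x\<in>U. cycle_poly (U - {x}) - cycle_poly U)"
proof -
  have "(\<Sum>c\<in>cycles U. cycle_term U c) = (\<Sum>x\<in>U. \<Sum>c | c \<in> cycles U \<and> hd c = x. cycle_term U c)"
    using assms finite_cycles[OF assms] cyclesD(1,2) by (subst sum.group) (blast intro: subsetD[OF _ hd_in_set])+
  then show ?thesis using assms by (simp add: fps_XD_cycle_poly cycle_poly_root)
qed

end

section \<open>Loop erasure\<close>

text \<open>Loops are detected in order of time, so a vertex appended after the first repetition
  does not affect it.\<close>

lemma loop_end_snoc:
  assumes "\<not> distinct xs"
  shows "loop_end (xs @ [v]) = loop_end xs"
proof -
  note p = loop_end_props[OF assms]
  show ?thesis
    unfolding loop_end_def[of "xs @ [v]"]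
  proof (rule Least_equality)
    obtain j where "j < loop_end xs" "xs ! j = xs ! loop_end xs" using p(2) by blast
    then show "loop_end xs < length (xs @ [v]) \<and> (\<exists>j<loop_end xs. (xs @ [v]) ! j = (xs @ [v]) ! loop_end xs)"
      using p(1) by (intro conjI exI[of _ j]) (simp_all add: nth_append)
  next
    fix y assume y: "y < length (xs @ [v]) \<and> (\<exists>j<y. (xs @ [v]) ! j = (xs @ [v]) ! y)"
    show "loop_end xs \<le> y"
    proof (cases "y < length xs")
      case True
      with y show ?thesis
        unfolding loop_end_def[of xs] by (intro Least_le) (auto simp: nth_append)
    next
      case False
      with p(1) show ?thesis by simp
    qed
  qed
qed

lemma loop_start_snoc:
  assumes "\<not> distinct xs"
  shows "loop_start (xs @ [v]) = loop_start xs"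
  unfolding loop_start_def[of "xs @ [v]"] loop_end_snoc[OF assms]
proof (rule Least_equality)
  note p = loop_end_props(1)[OF assms] loop_start_props[OF assms]
  show "(xs @ [v]) ! loop_start xs = (xs @ [v]) ! loop_end xs"
    using p by (simp add: nth_append)
  fix y assume y: "(xs @ [v]) ! y = (xs @ [v]) ! loop_end xs"
  show "loop_start xs \<le> y"
  proof (cases "y < length xs")
    case True
    with y p show ?thesis
      unfolding loop_start_def[of xs] by (intro Least_le) (auto simp: nth_append)
  next
    case False
    with p show ?thesis by simp
  qed
qed

lemma loop_end_start_distinct_snoc:
  assumes "distinct (a @ v # b)"
  shows "loop_end (a @ v # b @ [v]) = length (a @ v # b)"
    and "loop_start (a @ v # b @ [v]) = length a"
proof -
  show le: "loop_end (a @ v # b @ [v]) = length (a @ v # b)"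
    unfolding loop_end_def
  proof (rule Least_equality)
    show "length (a @ v # b) < length (a @ v # b @ [v]) \<and>
      (\<exists>j<length (a @ v # b). (a @ v # b @ [v]) ! j = (a @ v # b @ [v]) ! length (a @ v # b))"
      by (auto simp: nth_append intro!: exI[of _ "length a"])
    fix y assume y: "y < length (a @ v # b @ [v]) \<and> (\<exists>j<y. (a @ v # b @ [v]) ! j = (a @ v # b @ [v]) ! y)"
    show "length (a @ v # b) \<le> y"
    proof (rule ccontr)
      assume n: "\<not> length (a @ v # b) \<le> y"
      obtain j where j: "j < y" "((a @ v # b) @ [v]) ! j = ((a @ v # b) @ [v]) ! y"
        using y by auto
      then have "(a @ v # b) ! j = (a @ v # b) ! y"
        using n by (metis nth_append_left less_trans not_le)
      then show False
        using assms n j(1) by (metis nth_eq_iff_index_eq less_trans not_le less_irrefl)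
    qed
  qed
  show "loop_start (a @ v # b @ [v]) = length a"
    unfolding loop_start_def le
  proof (rule Least_equality)
    show "(a @ v # b @ [v]) ! length a = (a @ v # b @ [v]) ! length (a @ v # b)"
      by (simp add: nth_append)
    fix y assume y: "(a @ v # b @ [v]) ! y = (a @ v # b @ [v]) ! length (a @ v # b)"
    then have "(a @ v # b @ [v]) ! y = v" by (simp add: nth_append)
    then show "length a \<le> y"
      using assms by (metis disjoint_iff distinct_append list.set_intros(1) not_le nth_append_left nth_mem)
  qed
qed

lemma LE_distinct [simp]: "distinct xs \<Longrightarrow> LE xs = xs"
  and removed_loops_distinct [simp]: "distinct xs \<Longrightarrow> removed_loops xs = []"
  by (simp_all add: LE.simps[of xs] removed_loops.simps[of xs])

lemma distinct_LE [simp]: "distinct (LE xs)"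
proof (induction xs rule: LE.induct)
  case (1 xs)
  then show ?case by (cases "distinct xs") (simp_all add: LE.simps[of xs])
qed

text \<open>One step of chronological erasure, for a self-avoiding \<open>xs\<close>: if
  \<open>v\<close> is new, \<open>takeWhile\<close> keeps all of \<open>xs\<close>; otherwise the
  path is cut back to the earlier visit to \<open>v\<close>.\<close>

definition LE_snoc :: "'d vertex list \<Rightarrow> 'd vertex \<Rightarrow> 'd vertex list" where
  "LE_snoc xs v = takeWhile ((\<noteq>) v) xs @ [v]"

definition closed_loop :: "'d vertex list \<Rightarrow> 'd vertex \<Rightarrow> 'd vertex list list" where
  "closed_loop xs v = (if v \<in> set xs then [dropWhile ((\<noteq>) v) xs @ [v]] else [])"

text \<open>Loops are closed in chronological order, so erasing them commutes with appending a vertex.\<close>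

lemma LE_removed_loops_snoc:
  "LE (xs @ [v]) = LE_snoc (LE xs) v \<and> removed_loops (xs @ [v]) = removed_loops xs @ closed_loop (LE xs) v"
proof (induction xs rule: LE.induct)
  case (1 xs)
  show ?case
  proof (cases "distinct xs")
    case False
    have nd: "\<not> distinct (xs @ [v])" using False by simp
    have "single_loop_erasure (xs @ [v]) = single_loop_erasure xs @ [v]"
      using loop_end_props(1)[OF False] loop_start_props(1)[OF False]
      by (simp add: single_loop_erasure_def loop_end_snoc[OF False] loop_start_snoc[OF False])
    moreover have "removed_loop (xs @ [v]) = removed_loop xs"
      using loop_end_props(1)[OF False] loop_start_props(1)[OF False]
      by (simp add: removed_loop_def loop_end_snoc[OF False] loop_start_snoc[OF False])
    ultimately show ?thesis
      using 1 False nd LE.simps[of "xs @ [v]"] LE.simps[of xs]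
        removed_loops.simps[of "xs @ [v]"] removed_loops.simps[of xs] by simp
  next
    case True
    show ?thesis
    proof (cases "v \<in> set xs")
      case False
      have tw: "takeWhile ((\<noteq>) v) xs = xs" unfolding takeWhile_eq_all_conv using False by auto
      show ?thesis
        using True False by (simp add: LE_snoc_def closed_loop_def tw)
    next
      case vin: True
      \<comment> \<open>\<open>v\<close> closes the only loop \<open>v # b @ [v]\<close>; what
        remains is \<open>a @ [v]\<close>, without repetition, so the erasure stops after one
        round.\<close>
      obtain a b where ab: "xs = a @ v # b" "v \<notin> set a" using split_list_first[OF vin] by blast
      have "distinct (a @ v # b)" using True ab by simp
      note ls = loop_end_start_distinct_snoc[OF this]
      have nd: "\<not> distinct (xs @ [v])" using vin by simp
      have tw: "takeWhile ((\<noteq>) v) xs = a" "dropWhile ((\<noteq>) v) xs = v # b"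
        unfolding ab(1) by (subst takeWhile_append2 dropWhile_append2; use ab(2) in force)+
      have "single_loop_erasure (xs @ [v]) = a @ [v]"
        using ab(1) ls by (simp add: single_loop_erasure_def)
      moreover have "removed_loop (xs @ [v]) = v # b @ [v]"
        using ab(1) ls by (simp add: removed_loop_def)
      moreover have "distinct (a @ [v])" using True ab by simp
      ultimately show ?thesis
        using nd LE.simps[of "xs @ [v]"] removed_loops.simps[of "xs @ [v]"] True vin tw
        by (simp add: LE_snoc_def closed_loop_def)
    qed
  qed
qed

lemmas LE_snoc_eq = LE_removed_loops_snoc[THEN conjunct1]
lemmas removed_loops_snoc_eq = LE_removed_loops_snoc[THEN conjunct2]

lemma set_LE_subset: "set (LE xs) \<subseteq> set xs"
  by (induction xs rule: rev_induct) (auto simp: LE_snoc_eq LE_snoc_def dest: set_takeWhileD)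

lemma LE_eq_Nil_iff [simp]: "LE xs = [] \<longleftrightarrow> xs = []"
  by (cases xs rule: rev_cases) (auto simp: LE_snoc_eq LE_snoc_def)

lemma last_LE: "xs \<noteq> [] \<Longrightarrow> last (LE xs) = last xs"
  by (cases xs rule: rev_cases) (auto simp: LE_snoc_eq LE_snoc_def)

lemma hd_LE: "xs \<noteq> [] \<Longrightarrow> hd (LE xs) = hd xs"
proof (induction xs rule: rev_induct)
  case (snoc v xs)
  show ?case
  proof (cases "xs = []")
    case False
    then obtain a l where al: "LE xs = a # l" by (metis LE_eq_Nil_iff list.exhaust)
    then have "hd xs = a" using snoc.IH False by simp
    then show ?thesis using False al by (cases "a = v") (simp_all add: LE_snoc_eq LE_snoc_def)
  qed simp
qed simp

text \<open>Erasure keeps both endpoints, and a self-avoiding path with equal endpoints is a single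
  vertex. Thus loop erasure \<open>[x]\<close> characterizes closed walks at \<open>x\<close>, the
  trivial one included.\<close>

lemma LE_eq_singleton_iff: "LE xs = [x] \<longleftrightarrow> xs \<noteq> [] \<and> hd xs = x \<and> last xs = x"
proof
  assume *: "xs \<noteq> [] \<and> hd xs = x \<and> last xs = x"
  then have "LE xs \<noteq> []" "hd (LE xs) = x" "last (LE xs) = x" by (auto simp: hd_LE last_LE)
  then show "LE xs = [x]"
    using distinct_LE[of xs] by (metis distinct.simps(2) last_ConsR last_in_set list.exhaust_sel)
qed (metis LE_eq_Nil_iff hd_LE last_LE last.simps list.distinct(1) list.sel(1))

text \<open>Once \<open>c\<close> is erased to \<open>[x]\<close>, its history is the vertex
  \<open>x\<close> alone. As \<open>v\<close> never returns to \<open>x\<close>, the erasure of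
  \<open>v\<close> is undisturbed.\<close>

lemma LE_removed_loops_append:
  assumes "LE c = [x]" "x \<notin> set v"
  shows "LE (c @ v) = x # LE v \<and> removed_loops (c @ v) = removed_loops c @ removed_loops v"
  using assms(2)
proof (induction v rule: rev_induct)
  case Nil
  then show ?case using assms by simp
next
  case (snoc u v)
  then have IH: "LE (c @ v) = x # LE v" "removed_loops (c @ v) = removed_loops c @ removed_loops v"
    and "u \<noteq> x" by auto
  then show ?case
    unfolding append_assoc[symmetric] LE_snoc_eq removed_loops_snoc_eq
    by (auto simp: LE_snoc_def closed_loop_def)
qed

section \<open>Walks on the lattice\<close>

lemma adjacent_irrefl [simp]: "\<not> adjacent x x"
  by (simp add: adjacent_def)

lemma walk_iff: "walk \<omega> \<longleftrightarrow> \<omega> \<noteq> [] \<and> successively adjacent \<omega>"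
  by (auto simp: walk_def successively_conv_nth)

lemma adjacent_imp_coord_diff_le:
  assumes "adjacent x y"
  shows "\<bar>x $ i - y $ i\<bar> \<le> 1"
proof -
  have "dist (real_vec x $ i) (real_vec y $ i) \<le> 1"
    using assms dist_vec_nth_le[of "real_vec x" i "real_vec y"] by (simp add: adjacent_def)
  then have "\<bar>real_of_int (x $ i - y $ i)\<bar> \<le> 1"
    by (simp add: real_vec_def dist_real_def)
  then show ?thesis by linarith
qed

lemma coord_diff_le_of_successively:
  assumes "successively adjacent \<omega>" "x \<in> set \<omega>" "y \<in> set \<omega>"
  shows "\<bar>x $ i - y $ i\<bar> \<le> int (length \<omega>)"
proof -
  \<comment> \<open>The bound on the distance from the head is carried through the induction, since
    the vertex added in front is compared with the others through it.\<close>
  have *: "\<bar>hd \<omega> $ i - v $ i\<bar> \<le> int (length \<omega>) \<and> \<bar>u $ i - v $ i\<bar> \<le> int (length \<omega>)"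
    if "successively adjacent \<omega>" "u \<in> set \<omega>" "v \<in> set \<omega>" for \<omega> u v
    using that
  proof (induction \<omega> arbitrary: u v)
    case (Cons a \<omega>)
    show ?case
    proof (cases "\<omega> = []")
      case False
      then have adj: "adjacent a (hd \<omega>)" "successively adjacent \<omega>"
        using Cons.prems(1) by (auto simp: successively_Cons)
      have near: "\<bar>a $ i - u $ i\<bar> \<le> int (length \<omega>) + 1" if "u \<in> set \<omega>" for u
        using Cons.IH[OF adj(2) that that] adjacent_imp_coord_diff_le[OF adj(1), of i] by linarith
      have "\<bar>u $ i - v $ i\<bar> \<le> int (length \<omega>)" if "u \<in> set \<omega>" "v \<in> set \<omega>"
        using Cons.IH[OF adj(2) that] by simp
      then show ?thesis
        using Cons.prems(2,3) near[of u] near[of v] by (auto simp: abs_minus_commute)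
    qed (use Cons.prems in auto)
  qed simp
  show ?thesis using *[OF assms] by simp
qed

lemma finite_box: "finite {v :: 'd::finite vertex. \<forall>i. \<bar>x $ i - v $ i\<bar> \<le> n}"
proof (rule finite_subset)
  show "{v. \<forall>i. \<bar>x $ i - v $ i\<bar> \<le> n} \<subseteq> vec_lambda ` (PiE UNIV (\<lambda>i. {x $ i - n..x $ i + n}))"
  proof
    fix v assume "v \<in> {v. \<forall>i. \<bar>x $ i - v $ i\<bar> \<le> n}"
    then have "\<And>i. \<bar>x $ i - v $ i\<bar> \<le> n" by simp
    then have "x $ i - n \<le> v $ i \<and> v $ i \<le> x $ i + n" for i by (smt (verit))
    then have "vec_nth v \<in> PiE UNIV (\<lambda>i. {x $ i - n..x $ i + n})" by (auto simp: PiE_UNIV_domain)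
    then show "v \<in> vec_lambda ` (PiE UNIV (\<lambda>i. {x $ i - n..x $ i + n}))"
      by (rule image_eqI[rotated]) (simp add: vec_lambda_eta)
  qed
qed (auto intro!: finite_PiE)

text \<open>Such walks stay in a box around \<open>x\<close> whose size depends on \<open>n\<close>
  only. Hence walks forced through a finite set have well-defined generating functions in infinite
  domains as well.\<close>

lemma finite_walks_through:
  "finite {\<omega> :: 'd::finite vertex list. successively adjacent \<omega> \<and> x \<in> set \<omega> \<and> length \<omega> = n}"
proof (rule finite_subset)
  show "{\<omega>. successively adjacent \<omega> \<and> x \<in> set \<omega> \<and> length \<omega> = n}
      \<subseteq> {\<omega>. set \<omega> \<subseteq> {v. \<forall>i. \<bar>x $ i - v $ i\<bar> \<le> int n} \<and> length \<omega> = n}"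
    using coord_diff_le_of_successively by blast
qed (rule finite_lists_length_eq, rule finite_box)

lemma graded_length_of_steps:
  assumes "graded length A" shows "graded steps A"
  unfolding graded_def
proof
  fix n
  \<comment> \<open>\<open>steps\<close> gives 0 for the empty list too, hence the additional set of
    lists of length \<open>n\<close>.\<close>
  have "{a \<in> A. steps a = n} \<subseteq> {a \<in> A. length a = n} \<union> {a \<in> A. length a = Suc n}"
  proof
    fix a assume "a \<in> {a \<in> A. steps a = n}"
    then show "a \<in> {a \<in> A. length a = n} \<union> {a \<in> A. length a = Suc n}"
      by (cases a) (auto simp: steps_def)
  qed
  then show "finite {a \<in> A. steps a = n}"
    by (rule finite_subset) (use assms in \<open>simp add: graded_def\<close>)
qed

lemma graded_walks_through:
  assumes "finite B" "\<And>\<omega>. \<omega> \<in> A \<Longrightarrow> successively adjacent \<omega> \<and> set \<omega> \<inter> B \<noteq> {}"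
  shows "graded length A"
  unfolding graded_def
proof
  fix n
  have "{\<omega> \<in> A. length \<omega> = n} \<subseteq> (\<Union>x\<in>B. {\<omega>. successively adjacent \<omega> \<and> x \<in> set \<omega> \<and> length \<omega> = n})"
    using assms(2) by auto
  then show "finite {\<omega> \<in> A. length \<omega> = n}"
    by (rule finite_subset) (use assms(1) finite_walks_through in auto)
qed

lemma graded_walks_in:
  assumes "finite U" "\<And>\<omega>. \<omega> \<in> A \<Longrightarrow> set \<omega> \<subseteq> U"
  shows "graded length A"
  unfolding graded_def
proof
  fix n
  have "{\<omega> \<in> A. length \<omega> = n} \<subseteq> {\<omega>. set \<omega> \<subseteq> U \<and> length \<omega> = n}" using assms(2) by auto
  then show "finite {\<omega> \<in> A. length \<omega> = n}"
    by (rule finite_subset) (use assms(1) finite_lists_length_eq in auto)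
qed

lemma self_avoiding_polygon_snoc:
  assumes "c \<noteq> []" "distinct c" "successively adjacent (c @ [hd c])"
  shows "self_avoiding_polygon (c @ [hd c])"
proof -
  \<comment> \<open>A list of length 1 would make its vertex adjacent to itself.\<close>
  have "2 \<le> length c"
  proof (rule ccontr)
    assume "\<not> 2 \<le> length c"
    then obtain x where "c = [x]" using assms(1) by (cases c) (auto simp: Suc_le_eq)
    then show False using assms(3) by simp
  qed
  moreover have "i = 0 \<and> j = length c"
    if ij: "i < j" "j \<le> length c" "(c @ [hd c]) ! i = (c @ [hd c]) ! j" for i j
  proof -
    have j: "j = length c"
    proof (rule ccontr)
      assume "j \<noteq> length c"
      then have "c ! i = c ! j" using ij by (simp add: nth_append)
      then show False using ij \<open>j \<noteq> length c\<close> assms(2) by (simp add: nth_eq_iff_index_eq)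
    qed
    then have "c ! i = c ! 0" using ij assms(1) by (simp add: nth_append hd_conv_nth)
    then show ?thesis using j ij assms(1,2) by (auto simp: nth_eq_iff_index_eq)
  qed
  moreover have "steps (c @ [hd c]) = length c" by (simp add: steps_def)
  moreover have "(c @ [hd c]) ! 0 = (c @ [hd c]) ! length c"
    using assms(1) by (simp add: nth_append hd_conv_nth)
  ultimately show ?thesis
    using assms(3) unfolding self_avoiding_polygon_def walk_iff by auto
qed

text \<open>A removed loop is a final segment of the current self-avoiding path, closed by one
  further step. Its being a polygon brings the assumptions on the activities to bear and lets
  \<open>weight\<close> see every removed loop.\<close>

lemma successively_adjacent_LE:
  "successively adjacent \<omega> \<Longrightarrow> successively adjacent (LE \<omega>) \<and> (\<forall>C\<in>set (removed_loops \<omega>). self_avoiding_polygon C)"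
proof (induction \<omega> rule: rev_induct)
  case (snoc v \<omega>)
  have IH: "successively adjacent (LE \<omega>)" "\<forall>C\<in>set (removed_loops \<omega>). self_avoiding_polygon C"
    and adj: "LE \<omega> \<noteq> [] \<Longrightarrow> adjacent (last (LE \<omega>)) v"
    using snoc by (auto simp: successively_append_iff last_LE)
  have succ: "successively adjacent (LE \<omega> @ [v])"
    using IH adj by (auto simp: successively_append_iff)
  show ?case
  proof (cases "v \<in> set (LE \<omega>)")
    case False
    have tw: "takeWhile ((\<noteq>) v) (LE \<omega>) = LE \<omega>" unfolding takeWhile_eq_all_conv using False by auto
    then show ?thesis
      using IH succ False by (simp add: LE_snoc_eq removed_loops_snoc_eq LE_snoc_def closed_loop_def tw)
  next
    case True
    then obtain a b where ab: "LE \<omega> = a @ v # b" "v \<notin> set a" using split_list_first by metis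
    have tw: "takeWhile ((\<noteq>) v) (LE \<omega>) = a" "dropWhile ((\<noteq>) v) (LE \<omega>) = v # b"
      unfolding ab(1) by (subst takeWhile_append2 dropWhile_append2; use ab(2) in force)+
    have "distinct (v # b)" using ab(1) distinct_LE[of \<omega>] by simp
    moreover have "successively adjacent ((v # b) @ [hd (v # b)])" "successively adjacent (a @ [v])"
      using succ unfolding ab(1) by (auto simp: successively_append_iff)
    ultimately show ?thesis
      using IH True self_avoiding_polygon_snoc[of "v # b"]
      by (simp add: LE_snoc_eq removed_loops_snoc_eq LE_snoc_def closed_loop_def tw)
  qed
qed simp

section \<open>Weights as products over the removed loops\<close>

definition loop_product :: "('d::finite vertex list \<Rightarrow> real) \<Rightarrow> 'd vertex list \<Rightarrow> real" where
  "loop_product lam \<omega> = prod_list (map lam (removed_loops \<omega>))"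

lemma prod_power_count_list: "(\<Prod>x\<in>set xs. f x ^ count_list xs x) = (prod_list (map f xs) :: 'b::comm_monoid_mult)"
proof (induction xs)
  case (Cons a xs)
  have "(\<Prod>x\<in>set (a # xs). f x ^ count_list (a # xs) x)
      = f a ^ count_list (a # xs) a * (\<Prod>x\<in>set xs - {a}. f x ^ count_list (a # xs) x)"
    by (simp only: list.set prod.insert_remove[OF finite_set])
  also have "(\<Prod>x\<in>set xs - {a}. f x ^ count_list (a # xs) x) = (\<Prod>x\<in>set xs - {a}. f x ^ count_list xs x)"
    by (intro prod.cong) auto
  also have "f a ^ count_list (a # xs) a * (\<Prod>x\<in>set xs - {a}. f x ^ count_list xs x)
      = f a * (f a ^ count_list xs a * (\<Prod>x\<in>set xs - {a}. f x ^ count_list xs x))"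
    by (simp add: mult.assoc)
  also have "f a ^ count_list xs a * (\<Prod>x\<in>set xs - {a}. f x ^ count_list xs x) = (\<Prod>x\<in>set xs. f x ^ count_list xs x)"
    by (cases "a \<in> set xs") (simp_all add: prod.remove count_list_0_iff)
  finally show ?case using Cons by simp
qed simp

lemma weight_eq:
  assumes "walk \<omega>"
  shows "weight lam z \<omega> = loop_product lam \<omega> * z ^ steps \<omega>"
proof -
  have "{\<eta>. self_avoiding_polygon \<eta> \<and> n_L \<eta> \<omega> \<noteq> 0} = set (removed_loops \<omega>)"
    using successively_adjacent_LE[of \<omega>] assms by (auto simp: n_L_def count_list_0_iff walk_iff)
  then show ?thesis
    unfolding weight_def loop_product_def n_L_def
    by (simp add: prod_power_count_list)
qed

section \<open>Closed walks and loop-erased walks\<close>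

text \<open>The cut is at the last visit to \<open>x\<close>, which the whole list
  determines.\<close>

lemma append_last_inject:
  assumes "c @ v = c' @ v'" "c \<noteq> []" "c' \<noteq> []" "last c = x" "last c' = x" "x \<notin> set v" "x \<notin> set v'"
  shows "c = c' \<and> v = v'"
proof -
  obtain us where "c = c' @ us \<and> us @ v = v' \<or> c @ us = c' \<and> v = us @ v'"
    using assms(1) by (auto simp: append_eq_append_conv2)
  moreover have "us = []"
    using calculation assms by (metis Un_iff last_appendR last_in_set set_append)
  ultimately show ?thesis by auto
qed

lemma split_at_last_visit:
  assumes "\<omega> \<noteq> []" "hd \<omega> = x"
  obtains c v where "\<omega> = c @ v" "LE c = [x]" "x \<notin> set v"
proof -
  have "x \<in> set \<omega>" using assms hd_in_set by blast
  then obtain a v where av: "\<omega> = a @ x # v" "x \<notin> set v" by (metis split_list_last)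
  have "hd (a @ [x]) = x" using av(1) assms(2) by (cases a) auto
  then have "LE (a @ [x]) = [x]" by (simp add: LE_eq_singleton_iff)
  then show ?thesis using that[of "a @ [x]" v] av by simp
qed

text \<open>\<open>successively\<close> admits the empty list, so \<open>paths U []\<close> is
  \<open>{[]}\<close> and starts the recursion over \<eta>. The set \<open>paths U [x]\<close>
  consists of the closed walks at \<open>x\<close> in \<open>U\<close>.\<close>

definition paths :: "'d::finite vertex set \<Rightarrow> 'd vertex list \<Rightarrow> 'd vertex list set" where
  "paths U \<eta> = {v. successively adjacent v \<and> set v \<subseteq> U \<and> LE v = \<eta>}"

definition loops :: "'d::finite vertex set \<Rightarrow> 'd vertex set \<Rightarrow> 'd vertex list set" where
  "loops U A = {\<omega>. successively adjacent \<omega> \<and> 2 \<le> length \<omega> \<and> hd \<omega> = last \<omega> \<and> set \<omega> \<subseteq> U \<and> set \<omega> \<inter> A \<noteq> {}}"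

text \<open>The part of a walk strictly between two consecutive visits to \<open>x\<close>. Both
  copies of \<open>x\<close> are stripped, so that its loop erasure is the tail of the cycle closed
  on return.\<close>

definition excursions :: "'d::finite vertex set \<Rightarrow> 'd vertex \<Rightarrow> 'd vertex list set" where
  "excursions U x = {v. v \<noteq> [] \<and> successively adjacent (x # v @ [x]) \<and> set v \<subseteq> U - {x}}"

lemma paths_singletonD:
  assumes "c \<in> paths U [x]"
  shows "successively adjacent c" "set c \<subseteq> U" "LE c = [x]" "c \<noteq> []" "hd c = x" "last c = x"
  using assms LE_eq_singleton_iff[of c x] by (auto simp: paths_def)

lemma graded_paths: "graded length (paths U \<eta>)"
proof (cases "\<eta> = []")
  case True
  then have "paths U \<eta> \<subseteq> {[]}" by (auto simp: paths_def)
  then show ?thesis unfolding graded_def by (metis (no_types, lifting) finite.simps finite_subset mem_Collect_eq subsetI subset_trans)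
next
  case False
  show ?thesis
  proof (rule graded_walks_through[of "{hd \<eta>}"])
    fix \<omega> assume "\<omega> \<in> paths U \<eta>"
    then have "successively adjacent \<omega>" "LE \<omega> = \<eta>" "\<omega> \<noteq> []" using False by (auto simp: paths_def)
    then show "successively adjacent \<omega> \<and> set \<omega> \<inter> {hd \<eta>} \<noteq> {}"
      using hd_LE[of \<omega>] by auto
  qed simp
qed

lemma graded_loops: "finite A \<Longrightarrow> graded length (loops U A)"
  by (rule graded_walks_through[of A]) (auto simp: loops_def)

lemma graded_loops_in: "finite U \<Longrightarrow> graded length (loops U A)"
  by (rule graded_walks_in[of U]) (auto simp: loops_def)

text \<open>Cut a walk at its last visit to \<open>x\<close>: up to there it is a closed walk at
  \<open>x\<close>, afterwards it avoids \<open>x\<close> and carries the rest of the loop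
  erasure.\<close>

lemma bij_betw_append_paths:
  assumes "successively adjacent (x # \<eta>)" "x \<in> U"
  shows "bij_betw (\<lambda>(c, v). c @ v) (paths U [x] \<times> paths (U - {x}) \<eta>) (paths U (x # \<eta>))"
proof (rule bij_betw_imageI)
  show "inj_on (\<lambda>(c, v). c @ v) (paths U [x] \<times> paths (U - {x}) \<eta>)"
  proof (rule inj_onI, clarify)
    fix c v c' v'
    assume *: "c \<in> paths U [x]" "v \<in> paths (U - {x}) \<eta>" "c' \<in> paths U [x]" "v' \<in> paths (U - {x}) \<eta>"
      and "c @ v = c' @ v'"
    then show "c = c' \<and> v = v'"
      by (intro append_last_inject[of c v c' v' x])
        (use paths_singletonD(4,6)[OF *(1)] paths_singletonD(4,6)[OF *(3)] in \<open>auto simp: paths_def\<close>)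
  qed
  show "(\<lambda>(c, v). c @ v) ` (paths U [x] \<times> paths (U - {x}) \<eta>) = paths U (x # \<eta>)"
  proof (intro equalityI subsetI)
    fix \<omega> assume "\<omega> \<in> (\<lambda>(c, v). c @ v) ` (paths U [x] \<times> paths (U - {x}) \<eta>)"
    then obtain c v where cv: "\<omega> = c @ v" "c \<in> paths U [x]" "v \<in> paths (U - {x}) \<eta>" by auto
    note c = paths_singletonD[OF cv(2)]
    have v: "successively adjacent v" "set v \<subseteq> U - {x}" "LE v = \<eta>" using cv(3) by (auto simp: paths_def)
    have "adjacent x (hd v)" if "v \<noteq> []"
      using that assms(1) v(3) hd_LE[of v] by (auto simp: successively_Cons)
    then show "\<omega> \<in> paths U (x # \<eta>)"
      using c v LE_removed_loops_append[of c x v] by (auto simp: paths_def cv(1) successively_append_iff)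
  next
    fix \<omega> assume \<omega>: "\<omega> \<in> paths U (x # \<eta>)"
    then have ne: "\<omega> \<noteq> []" by (auto simp: paths_def)
    moreover have "hd \<omega> = x" using hd_LE[OF ne] \<omega> by (simp add: paths_def)
    ultimately obtain c v where cv: "\<omega> = c @ v" "LE c = [x]" "x \<notin> set v" by (rule split_at_last_visit)
    then have "LE v = \<eta>" using LE_removed_loops_append[of c x v] \<omega> by (simp add: paths_def)
    then have "c \<in> paths U [x]" "v \<in> paths (U - {x}) \<eta>"
      using cv \<omega> by (auto simp: paths_def successively_append_iff)
    then show "\<omega> \<in> (\<lambda>(c, v). c @ v) ` (paths U [x] \<times> paths (U - {x}) \<eta>)"
      using cv(1) by auto
  qed
qed

text \<open>Cut a nontrivial closed walk at its last visit to \<open>x\<close> before the final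
  one.\<close>

lemma bij_betw_append_excursions:
  assumes "x \<in> U"
  shows "bij_betw (\<lambda>(c, v). c @ v @ [x]) (paths U [x] \<times> excursions U x) {\<omega> \<in> paths U [x]. 2 \<le> length \<omega>}"
proof (rule bij_betw_imageI)
  show "inj_on (\<lambda>(c, v). c @ v @ [x]) (paths U [x] \<times> excursions U x)"
  proof (rule inj_onI, clarify)
    fix c v c' v'
    assume *: "c \<in> paths U [x]" "v \<in> excursions U x" "c' \<in> paths U [x]" "v' \<in> excursions U x"
      and "c @ v @ [x] = c' @ v' @ [x]"
    then have "c @ v = c' @ v'" by (metis append_assoc append_same_eq)
    then show "c = c' \<and> v = v'"
      by (rule append_last_inject[of c v c' v' x]) (use * paths_singletonD(4,6)[OF *(1)] paths_singletonD(4,6)[OF *(3)] in \<open>auto simp: excursions_def\<close>)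
  qed
  show "(\<lambda>(c, v). c @ v @ [x]) ` (paths U [x] \<times> excursions U x) = {\<omega> \<in> paths U [x]. 2 \<le> length \<omega>}"
  proof (intro equalityI subsetI)
    fix \<omega> assume "\<omega> \<in> (\<lambda>(c, v). c @ v @ [x]) ` (paths U [x] \<times> excursions U x)"
    then obtain c v where cv: "\<omega> = c @ v @ [x]" "c \<in> paths U [x]" "v \<in> excursions U x" by auto
    note c = paths_singletonD[OF cv(2)]
    have "hd \<omega> = x" "last \<omega> = x" "\<omega> \<noteq> []" "2 \<le> length \<omega>"
      using c(4,5) by (auto simp: cv(1) Suc_le_eq)
    moreover have "successively adjacent \<omega>"
      using cv(3) c by (auto simp: cv(1) excursions_def successively_append_iff successively_Cons)
    moreover have "set \<omega> \<subseteq> U" using cv(3) c assms by (auto simp: cv(1) excursions_def)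
    ultimately show "\<omega> \<in> {\<omega> \<in> paths U [x]. 2 \<le> length \<omega>}"
      using LE_eq_singleton_iff[of \<omega> x] by (simp add: paths_def)
  next
    fix \<omega> assume "\<omega> \<in> {\<omega> \<in> paths U [x]. 2 \<le> length \<omega>}"
    then have \<omega>: "\<omega> \<in> paths U [x]" "2 \<le> length \<omega>" by auto
    note p = paths_singletonD[OF \<omega>(1)]
    obtain \<omega>' where \<omega>': "\<omega> = \<omega>' @ [x]" using p(4,6) by (metis append_butlast_last_id)
    have "\<omega>' \<noteq> []" using \<omega>' \<omega>(2) by auto
    moreover have "hd \<omega>' = x" using \<omega>' p(5) calculation by simp
    ultimately obtain c v where cv: "\<omega>' = c @ v" "LE c = [x]" "x \<notin> set v" by (rule split_at_last_visit)
    have c: "c \<noteq> []" "last c = x" using cv(2) LE_eq_singleton_iff[of c x] by auto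
    have succ: "successively adjacent (c @ v @ [x])" using p(1) \<omega>' cv(1) by simp
    have "v \<noteq> []"
      using succ c by (auto simp: successively_append_iff)
    then have "v \<in> excursions U x"
      using succ c p(2) cv \<omega>' by (auto simp: excursions_def successively_append_iff successively_Cons)
    moreover have "c \<in> paths U [x]"
      using succ cv p(2) \<omega>' by (auto simp: paths_def successively_append_iff)
    ultimately show "\<omega> \<in> (\<lambda>(c, v). c @ v @ [x]) ` (paths U [x] \<times> excursions U x)"
      using \<omega>' cv(1) by auto
  qed
qed

lemma loop_product_append:
  "LE c = [x] \<Longrightarrow> x \<notin> set v \<Longrightarrow> loop_product lam (c @ v) = loop_product lam c * loop_product lam v"
  using LE_removed_loops_append[of c x v] by (simp add: loop_product_def)

text \<open>Just before the final step the erased path is \<open>x # LE v\<close>, so the return to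
  \<open>x\<close> closes all of it as one loop.\<close>

lemma loop_product_excursion:
  assumes "LE c = [x]" "x \<notin> set v"
  shows "loop_product lam (c @ v @ [x]) = loop_product lam c * (loop_product lam v * lam (x # LE v @ [x]))"
proof -
  have "loop_product lam ((c @ v) @ [x]) = loop_product lam (c @ v) * lam (x # LE v @ [x])"
    using LE_removed_loops_append[OF assms] by (simp add: loop_product_def removed_loops_snoc_eq closed_loop_def del: append_assoc)
  then show ?thesis using assms by (simp add: loop_product_append)
qed

text \<open>Polygons without their repeated final vertex, still rooted and oriented. Length 1 is
  ruled out because no vertex is adjacent to itself.\<close>

definition simple_cycles :: "'d::finite vertex list set" where
  "simple_cycles = {c. c \<noteq> [] \<and> distinct c \<and> successively adjacent (c @ [hd c])}"

lemma rotate1_simple_cycles: "c \<in> simple_cycles \<Longrightarrow> rotate1 c \<in> simple_cycles"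
proof -
  assume c: "c \<in> simple_cycles"
  obtain x ys where xys: "c = x # ys" using c by (cases c) (auto simp: simple_cycles_def)
  show ?thesis
    using c unfolding xys simple_cycles_def
    by (cases ys) (auto simp: successively_append_iff successively_Cons hd_append split: if_splits)
qed

locale activities =
  fixes lam :: "'d::finite vertex list \<Rightarrow> real"
  assumes loop_activities: "loop_activities lam"
begin

definition cycle_activity :: "'d vertex list \<Rightarrow> real" where
  "cycle_activity c = lam (c @ [hd c])"

lemma cycle_activity_rotate1:
  assumes c: "c \<in> simple_cycles"
  shows "cycle_activity (rotate1 c) = cycle_activity c"
proof -
  have "self_avoiding_polygon (d @ [hd d])" if "d \<in> simple_cycles" for d :: "'d vertex list"
    using that by (intro self_avoiding_polygon_snoc) (auto simp: simple_cycles_def)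
  then have "self_avoiding_polygon (c @ [hd c])" "self_avoiding_polygon (rotate1 c @ [hd (rotate1 c)])"
    using c rotate1_simple_cycles by auto
  \<comment> \<open>Invariance under a change of initial vertex enters here, with a rotation by one
    position.\<close>
  moreover have "same_unrooted_polygon (c @ [hd c]) (rotate1 c @ [hd (rotate1 c)])"
    unfolding same_unrooted_polygon_def by (intro exI[of _ 1] disjI1) simp
  ultimately show ?thesis
    using loop_activities unfolding loop_activities_def cycle_activity_def by metis
qed

sublocale cycle_weights simple_cycles cycle_activity
  by unfold_locales (use rotate1_simple_cycles cycle_activity_rotate1 in \<open>auto simp: simple_cycles_def\<close>)

lemma loop_product_nonneg:
  assumes "successively adjacent \<omega>"
  shows "0 \<le> loop_product lam \<omega>"
proof -
  have "\<forall>C\<in>set (removed_loops \<omega>). 0 \<le> lam C"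
    using successively_adjacent_LE[OF assms] loop_activities by (simp add: loop_activities_def)
  then show ?thesis unfolding loop_product_def by (induction "removed_loops \<omega>") (auto intro!: prod_list_nonneg)
qed

section \<open>Generating functions of walks and the last-loop equation\<close>

definition green :: "'d vertex set \<Rightarrow> 'd vertex \<Rightarrow> real fps" where
  "green U x = genfun steps (loop_product lam) (paths U [x])"

text \<open>Counts vertices instead of steps, so that concatenation adds sizes and the empty list
  contributes 1.\<close>

definition path_gf :: "'d vertex set \<Rightarrow> 'd vertex list \<Rightarrow> real fps" where
  "path_gf U \<eta> = genfun length (loop_product lam) (paths U \<eta>)"

definition loop_gf :: "'d vertex set \<Rightarrow> 'd vertex set \<Rightarrow> real fps" where
  "loop_gf U A = genfun steps (loop_product lam) (loops U A)"

lemma path_gf_Nil: "path_gf U [] = 1"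
proof -
  have "paths U [] = {[]}" by (auto simp: paths_def)
  then show ?thesis
    by (intro fps_ext) (simp add: path_gf_def genfun_nth loop_product_def)
qed

lemma path_gf_Cons:
  assumes "successively adjacent (x # \<eta>)" "x \<in> U"
  shows "path_gf U (x # \<eta>) = fps_X * (green U x * path_gf (U - {x}) \<eta>)"
proof -
  let ?P = "paths U [x] \<times> paths (U - {x}) \<eta>" and ?L = "loop_product lam"
  have "path_gf U (x # \<eta>)
      = genfun (\<lambda>(c, v). (steps c + length v) + 1) (\<lambda>(c, v). ?L c * ?L v) ?P"
    unfolding path_gf_def
  proof (rule genfun_reindex[OF bij_betw_append_paths[OF assms]], goal_cases)
    case (1 a)
    then show ?case by (auto simp: steps_def Suc_le_eq dest: paths_singletonD(4))
  next
    case (2 a)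
    then show ?case by (auto simp: paths_def intro!: loop_product_append)
  qed
  also have "\<dots> = fps_X ^ 1 * genfun (\<lambda>(c, v). steps c + length v) (\<lambda>(c, v). ?L c * ?L v) ?P"
    by (rule genfun_fps_X_power_mult) auto
  also have "\<dots> = fps_X * (green U x * path_gf (U - {x}) \<eta>)"
    by (simp add: green_def path_gf_def genfun_times graded_paths graded_length_of_steps)
  finally show ?thesis .
qed

lemma green_eq:
  assumes "x \<in> U"
  shows "green U x = 1 + genfun steps (loop_product lam) {\<omega> \<in> paths U [x]. 2 \<le> length \<omega>}"
proof -
  have "paths U [x] = {[x]} \<union> {\<omega> \<in> paths U [x]. 2 \<le> length \<omega>}"
  proof (intro equalityI subsetI)
    fix \<omega> assume \<omega>: "\<omega> \<in> paths U [x]"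
    note p = paths_singletonD[OF \<omega>]
    show "\<omega> \<in> {[x]} \<union> {\<omega> \<in> paths U [x]. 2 \<le> length \<omega>}"
      using \<omega> p(4,5) by (cases \<omega>; cases "tl \<omega>") auto
  qed (use assms in \<open>auto simp: paths_def\<close>)
  moreover have "graded steps {\<omega> \<in> paths U [x]. 2 \<le> length \<omega>}"
    by (rule graded_subset[OF graded_length_of_steps[OF graded_paths]]) auto
  moreover have "graded steps {[x]}" by (simp add: graded_def)
  ultimately have "green U x = genfun steps (loop_product lam) {[x]}
      + genfun steps (loop_product lam) {\<omega> \<in> paths U [x]. 2 \<le> length \<omega>}"
    unfolding green_def by (subst \<open>paths U [x] = _\<close>, intro genfun_Un) auto
  also have "genfun steps (loop_product lam) {[x]} = 1"
  proof (rule fps_ext)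
    fix n
    have "{a. a \<in> {[x]} \<and> steps a = n} = (if n = 0 then {[x]} else {})" by (auto simp: steps_def)
    then show "fps_nth (genfun steps (loop_product lam) {[x]}) n = fps_nth 1 n"
      unfolding genfun_nth by (simp add: loop_product_def)
  qed
  finally show ?thesis .
qed

lemma green_nth_0: "x \<in> U \<Longrightarrow> fps_nth (green U x) 0 = 1"
proof -
  have "{a. (a \<in> paths U [x] \<and> 2 \<le> length a) \<and> steps a = 0} = {}" by (auto simp: steps_def)
  then show "x \<in> U \<Longrightarrow> ?thesis" by (simp add: green_eq genfun_nth del: Collect_empty_eq)
qed

text \<open>A nontrivial closed walk at \<open>x\<close> is a closed walk followed by one excursion.
  Excursions are sorted by the cycle \<open>c\<close> that the return to \<open>x\<close> closes:
  given \<open>c\<close>, the excursion is any walk in \<open>U - {x}\<close> with loop erasure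
  \<open>tl c\<close>.\<close>

lemma green_renewal:
  assumes fin: "finite U" and x: "x \<in> U"
  shows "green U x = 1 + green U x *
    (\<Sum>c | c \<in> cycles U \<and> hd c = x. fps_const (cycle_activity c) * (fps_X * path_gf (U - {x}) (tl c)))"
proof -
  \<comment> \<open>An excursion with \<open>k\<close> inner vertices takes \<open>k + 1\<close>
    steps, the return to \<open>x\<close> included.\<close>
  let ?L = "loop_product lam" and ?I = "{c \<in> cycles U. hd c = x}" and ?s = "\<lambda>v. length v + 1"
  let ?f = "\<lambda>v. ?L v * lam (x # LE v @ [x])"
  have gr: "graded ?s (excursions U x)"
  proof -
    have "graded length (excursions U x)"
      by (rule graded_walks_in[OF fin]) (auto simp: excursions_def)
    moreover have "{v \<in> excursions U x. ?s v = n} \<subseteq> {v \<in> excursions U x. length v = n - 1}" for n by auto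
    ultimately show ?thesis unfolding graded_def using finite_subset by blast
  qed
  have "genfun steps ?L {\<omega> \<in> paths U [x]. 2 \<le> length \<omega>}
      = genfun (\<lambda>(c, v). steps c + ?s v) (\<lambda>(c, v). ?L c * ?f v) (paths U [x] \<times> excursions U x)"
  proof (rule genfun_reindex[OF bij_betw_append_excursions[OF x]], goal_cases)
    case (1 a)
    then show ?case by (auto simp: steps_def Suc_le_eq dest: paths_singletonD(4))
  next
    case (2 a)
    then show ?case by (auto simp: paths_def excursions_def intro!: loop_product_excursion)
  qed
  also have "\<dots> = green U x * genfun ?s ?f (excursions U x)"
    unfolding green_def by (rule genfun_times[OF graded_length_of_steps[OF graded_paths] gr])
  also have "genfun ?s ?f (excursions U x) = (\<Sum>c\<in>?I. genfun ?s ?f {v \<in> excursions U x. x # LE v = c})"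
  proof (rule genfun_group[OF gr])
    show "finite ?I" using finite_cycles[OF fin] by simp
    show "(\<lambda>v. x # LE v) ` excursions U x \<subseteq> ?I"
    proof clarify
      fix v assume v: "v \<in> excursions U x"
      then have vv: "v \<noteq> []" "successively adjacent v" "adjacent x (hd v)" "adjacent (last v) x" "set v \<subseteq> U - {x}"
        by (auto simp: excursions_def successively_append_iff successively_Cons)
      then have "successively adjacent (x # LE v @ [x])"
        using successively_adjacent_LE[of v] hd_LE[of v] last_LE[of v]
        by (auto simp: successively_append_iff successively_Cons)
      moreover have "set (LE v) \<subseteq> U - {x}" using set_LE_subset[of v] vv(5) by blast
      ultimately show "x # LE v \<in> cycles U \<and> hd (x # LE v) = x"
        using x unfolding cycles_def by (auto simp: simple_cycles_def)
    qed
  qed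
  also have "\<dots> = (\<Sum>c\<in>?I. fps_const (cycle_activity c) * (fps_X * path_gf (U - {x}) (tl c)))"
  proof (rule sum.cong[OF refl])
    fix c assume "c \<in> ?I"
    then have "c \<in> simple_cycles" "hd c = x" using cyclesD(4) by auto
    then have c: "c = x # tl c" "successively adjacent (x # tl c @ [x])"
      by (cases c; auto simp: simple_cycles_def)+
    \<comment> \<open>A cycle has at least two vertices; this makes \<open>v\<close> nonempty
      below.\<close>
    have "tl c \<noteq> []" using c(2) by auto
    have set_eq: "{v \<in> excursions U x. x # LE v = c} = paths (U - {x}) (tl c)"
    proof (intro equalityI subsetI)
      fix v assume "v \<in> {v \<in> excursions U x. x # LE v = c}"
      then show "v \<in> paths (U - {x}) (tl c)"
        by (auto simp: excursions_def paths_def successively_append_iff successively_Cons)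
    next
      fix v assume "v \<in> paths (U - {x}) (tl c)"
      then have v: "successively adjacent v" "set v \<subseteq> U - {x}" "LE v = tl c" "v \<noteq> []"
        using \<open>tl c \<noteq> []\<close> by (auto simp: paths_def)
      then show "v \<in> {v \<in> excursions U x. x # LE v = c}"
        using c hd_LE[of v] last_LE[of v] \<open>tl c \<noteq> []\<close>
        by (auto simp: excursions_def successively_append_iff successively_Cons)
    qed
    have "genfun ?s ?f (paths (U - {x}) (tl c)) = fps_const (cycle_activity c) * genfun ?s ?L (paths (U - {x}) (tl c))"
    proof (rule genfun_fps_const_mult)
      fix v assume "v \<in> paths (U - {x}) (tl c)"
      then have "x # LE v = c" using c(1) by (simp add: paths_def)
      then show "?L v * lam (x # LE v @ [x]) = cycle_activity c * ?L v"
        by (auto simp: cycle_activity_def)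
    qed
    also have "genfun ?s ?L (paths (U - {x}) (tl c)) = fps_X ^ 1 * path_gf (U - {x}) (tl c)"
      unfolding path_gf_def by (rule genfun_fps_X_power_mult) simp
    finally show "genfun ?s ?f {v \<in> excursions U x. x # LE v = c}
        = fps_const (cycle_activity c) * (fps_X * path_gf (U - {x}) (tl c))"
      by (simp add: set_eq)
  qed
  finally show ?thesis by (intro trans[OF green_eq[OF x]] arg_cong2[of _ _ _ _ "(+)"] refl)
qed

section \<open>Green functions as quotients of cycle polynomials\<close>

lemma path_gf_times_cycle_poly:
  assumes "\<And>V y. V \<subseteq> U \<Longrightarrow> y \<in> V \<Longrightarrow> green V y * cycle_poly V = cycle_poly (V - {y})"
    and "successively adjacent \<eta>" "distinct \<eta>" "set \<eta> \<subseteq> U"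
  shows "path_gf U \<eta> * cycle_poly U = fps_X ^ length \<eta> * cycle_poly (U - set \<eta>)"
  using assms
proof (induction \<eta> arbitrary: U)
  case Nil
  then show ?case by (simp add: path_gf_Nil)
next
  case (Cons x \<eta>)
  have "successively adjacent \<eta>" using Cons.prems(2) by (auto simp: successively_Cons)
  \<comment> \<open>The quotients telescope: the factor \<open>green U x\<close> turns
    \<open>cycle_poly U\<close> into \<open>cycle_poly (U - {x})\<close>, and the induction
    hypothesis continues from there.\<close>
  have "path_gf U (x # \<eta>) * cycle_poly U = fps_X * (path_gf (U - {x}) \<eta> * (green U x * cycle_poly U))"
    using path_gf_Cons[OF Cons.prems(2), of U] Cons.prems(4) by (simp add: mult_ac)
  also have "green U x * cycle_poly U = cycle_poly (U - {x})" using Cons.prems by auto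
  also have "path_gf (U - {x}) \<eta> * cycle_poly (U - {x}) = fps_X ^ length \<eta> * cycle_poly (U - {x} - set \<eta>)"
    using Cons.prems \<open>successively adjacent \<eta>\<close> by (intro Cons.IH) auto
  also have "U - {x} - set \<eta> = U - set (x # \<eta>)" by auto
  finally show ?case by (simp add: mult_ac)
qed

text \<open>Induction on the size of \<open>U\<close>. Apart from \<open>green U x\<close> itself,
  the last-loop equation involves only walks in \<open>U - {x}\<close>, known by induction.
  Multiplied by \<open>cycle_poly (U - {x})\<close>, its sum over cycles becomes the sum of
  \<open>cycle_term U c\<close>, which \<open>cycle_poly_root\<close> evaluates; the result is
  solved for \<open>green U x * cycle_poly U\<close>.\<close>

lemma green_times_cycle_poly:
  assumes "finite U" "x \<in> U"
  shows "green U x * cycle_poly U = cycle_poly (U - {x})"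
  using assms
proof (induction "card U" arbitrary: U x rule: less_induct)
  case less
  note fin = less.prems(1) and x = less.prems(2)
  let ?I = "{c \<in> cycles U. hd c = x}"
  let ?S = "\<Sum>c\<in>?I. fps_const (cycle_activity c) * (fps_X * path_gf (U - {x}) (tl c))"
  have IH: "green V y * cycle_poly V = cycle_poly (V - {y})" if "V \<subseteq> U - {x}" "y \<in> V" for V y
    using that fin x by (intro less.hyps psubset_card_mono finite_subset[of V "U - {x}"]) auto
  have "cycle_poly (U - {x}) * ?S = (\<Sum>c\<in>?I. cycle_term U c)"
    unfolding sum_distrib_left
  proof (rule sum.cong[OF refl])
    fix c assume c: "c \<in> ?I"
    then have cc: "c \<noteq> []" "set c \<subseteq> U" "distinct c" "c \<in> simple_cycles" "hd c = x"
      using cyclesD[of c U] by simp_all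
    then have eq: "c = x # tl c" by (metis list.collapse)
    have "x \<notin> set (tl c)" "distinct (tl c)" using eq cc(3) by (metis distinct.simps(2))+
    moreover have "set (tl c) \<subseteq> U" using eq cc(2) by (metis set_subset_Cons subset_trans)
    moreover have "successively adjacent (tl c)"
    proof -
      have "successively adjacent (x # tl c @ [x])"
        using cc(4,5) by (cases c) (auto simp: simple_cycles_def)
      then show ?thesis by (auto simp: successively_Cons successively_append_iff)
    qed
    ultimately have P: "path_gf (U - {x}) (tl c) * cycle_poly (U - {x}) = fps_X ^ length (tl c) * cycle_poly (U - {x} - set (tl c))"
      using IH by (intro path_gf_times_cycle_poly) auto
    have "set c = insert x (set (tl c))" by (subst eq) simp
    then have V: "U - {x} - set (tl c) = U - set c" by auto
    have len: "length c = Suc (length (tl c))" by (subst eq) simp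
    have "cycle_poly (U - {x}) * (fps_const (cycle_activity c) * (fps_X * path_gf (U - {x}) (tl c)))
        = fps_const (cycle_activity c) * (fps_X * (path_gf (U - {x}) (tl c) * cycle_poly (U - {x})))"
      by (simp only: mult_ac)
    also have "\<dots> = cycle_term U c"
      unfolding P V cycle_term_def len by (simp only: power_Suc mult_ac)
    finally show "cycle_poly (U - {x}) * (fps_const (cycle_activity c) * (fps_X * path_gf (U - {x}) (tl c))) = cycle_term U c" .
  qed
  also have "\<dots> = cycle_poly (U - {x}) - cycle_poly U" using cycle_poly_root[OF fin x] by simp
  finally have S: "cycle_poly (U - {x}) * ?S = cycle_poly (U - {x}) - cycle_poly U" .
  have "green U x * cycle_poly (U - {x}) = cycle_poly (U - {x}) + green U x * (cycle_poly (U - {x}) * ?S)"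
    by (subst green_renewal[OF fin x]) (simp add: algebra_simps)
  then show ?case unfolding S by (simp add: algebra_simps)
qed

section \<open>Logarithmic derivatives as counts of closed walks\<close>

lemma loop_gf_insert:
  assumes "graded length (loops U (insert x A))"
  shows "loop_gf U (insert x A) = loop_gf U {x} + loop_gf (U - {x}) A"
proof -
  have "loops U (insert x A) = loops U {x} \<union> loops (U - {x}) A" "loops U {x} \<inter> loops (U - {x}) A = {}"
    by (auto simp: loops_def)
  then show ?thesis
    unfolding loop_gf_def using graded_length_of_steps[OF assms]
    by (metis Un_upper1 Un_upper2 genfun_Un graded_subset)
qed

lemma loop_gf_UNIV:
  assumes "finite U"
  shows "loop_gf U UNIV = (\<Sum>x\<in>U. green U x - 1)"
proof -
  have "loop_gf U UNIV = (\<Sum>x\<in>U. genfun steps (loop_product lam) {\<omega> \<in> loops U UNIV. hd \<omega> = x})"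
    unfolding loop_gf_def
    by (rule genfun_group[OF graded_length_of_steps[OF graded_loops_in[OF assms]] assms])
      (auto simp: loops_def)
  also have "\<dots> = (\<Sum>x\<in>U. green U x - 1)"
  proof (rule sum.cong[OF refl])
    fix x assume x: "x \<in> U"
    have "{\<omega> \<in> loops U UNIV. hd \<omega> = x} = {\<omega> \<in> paths U [x]. 2 \<le> length \<omega>}"
      by (auto simp: loops_def paths_def LE_eq_singleton_iff)
    then show "genfun steps (loop_product lam) {\<omega> \<in> loops U UNIV. hd \<omega> = x} = green U x - 1"
      using green_eq[OF x] by simp
  qed
  finally show ?thesis .
qed

text \<open>Dividing the Euler derivative by \<open>cycle_poly U\<close> leaves, up to sign, the
  nontrivial closed walks at each vertex of \<open>U\<close>, hence all loops in
  \<open>U\<close>.\<close>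

lemma fps_XD_cycle_poly_loop_gf:
  assumes "finite U"
  shows "fps_XD (cycle_poly U) = - loop_gf U UNIV * cycle_poly U"
proof -
  have "(\<Sum>x\<in>U. cycle_poly (U - {x}) - cycle_poly U) = (\<Sum>x\<in>U. (green U x - 1) * cycle_poly U)"
    using green_times_cycle_poly[OF assms] by (intro sum.cong) (auto simp: algebra_simps)
  then show ?thesis
    using assms by (simp add: fps_XD_cycle_poly_root loop_gf_UNIV sum_distrib_right)
qed

text \<open>The logarithmic derivative of the quotient
  \<open>cycle_poly (U - {x}) / cycle_poly U\<close> is the difference between the loops in
  \<open>U\<close> and those in \<open>U - {x}\<close>: the loops through \<open>x\<close>.\<close>

lemma fps_XD_green_finite:
  assumes "finite U" "x \<in> U"
  shows "fps_XD (green U x) = green U x * loop_gf U {x}"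
proof -
  have W: "loop_gf U UNIV = loop_gf U {x} + loop_gf (U - {x}) UNIV"
    using loop_gf_insert[of U x UNIV] graded_loops_in[OF assms(1)] by simp
  have "fps_XD (green U x) * cycle_poly U - green U x * loop_gf U UNIV * cycle_poly U
      = fps_XD (green U x * cycle_poly U)"
    using assms by (simp add: fps_XD_mult fps_XD_cycle_poly_loop_gf)
  also have "\<dots> = - loop_gf (U - {x}) UNIV * (green U x * cycle_poly U)"
    using assms by (simp add: green_times_cycle_poly fps_XD_cycle_poly_loop_gf)
  finally have "fps_XD (green U x) * cycle_poly U = green U x * loop_gf U {x} * cycle_poly U"
    unfolding W by (simp add: algebra_simps)
  then show ?thesis by simp
qed

text \<open>Up to degree \<open>n\<close> only walks through \<open>x\<close> with at most
  \<open>n\<close> steps matter, and these fit into a finite subset of \<open>U\<close>, where the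
  identity is known.\<close>

lemma fps_XD_green:
  assumes "x \<in> U"
  shows "fps_XD (green U x) = green U x * loop_gf U {x}"
proof (rule fps_ext)
  fix n
  \<comment> \<open>A walk with \<open>n\<close> steps has \<open>n + 1\<close> vertices, hence the
    bound \<open>Suc n\<close> on the length.\<close>
  define S where "S = (\<Union>k\<in>{..Suc n}. {\<omega>. successively adjacent \<omega> \<and> x \<in> set \<omega> \<and> length \<omega> = k})"
  define V where "V = insert x (U \<inter> (\<Union>\<omega>\<in>S. set \<omega>))"
  have "finite S" unfolding S_def using finite_walks_through by (intro finite_UN_I) auto
  then have finV: "finite V" unfolding V_def by simp
  have xV: "x \<in> V" by (simp add: V_def)
  have "V \<subseteq> U" using assms by (auto simp: V_def)
  have inV: "set \<omega> \<subseteq> V" if "successively adjacent \<omega>" "x \<in> set \<omega>" "steps \<omega> \<le> n" "set \<omega> \<subseteq> U" for \<omega>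
  proof -
    have "length \<omega> \<le> Suc n" using that(3) by (simp add: steps_def)
    then have "\<omega> \<in> S" using that(1,2) by (auto simp: S_def)
    then show ?thesis using that(4) by (auto simp: V_def)
  qed
  have paths_eq: "{\<omega> \<in> paths U [x]. steps \<omega> = k} = {\<omega> \<in> paths V [x]. steps \<omega> = k}" if "k \<le> n" for k
  proof (intro equalityI subsetI)
    fix \<omega> assume \<omega>: "\<omega> \<in> {\<omega> \<in> paths U [x]. steps \<omega> = k}"
    then have p: "\<omega> \<in> paths U [x]" by simp
    have "x \<in> set \<omega>" using paths_singletonD(4,5)[OF p] hd_in_set by metis
    then show "\<omega> \<in> {\<omega> \<in> paths V [x]. steps \<omega> = k}"
      using \<omega> inV[of \<omega>] that by (auto simp: paths_def)
  qed (use \<open>V \<subseteq> U\<close> in \<open>auto simp: paths_def\<close>)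
  have loops_eq: "{\<omega> \<in> loops U {x}. steps \<omega> = k} = {\<omega> \<in> loops V {x}. steps \<omega> = k}" if "k \<le> n" for k
    using inV \<open>V \<subseteq> U\<close> that by (auto simp: loops_def)
  have "fps_nth (fps_XD (green U x)) n = fps_nth (fps_XD (green V x)) n"
    by (simp add: green_def genfun_nth paths_eq)
  also have "\<dots> = fps_nth (green V x * loop_gf V {x}) n"
    by (simp only: fps_XD_green_finite[OF finV xV])
  also have "\<dots> = fps_nth (green U x * loop_gf U {x}) n"
    unfolding fps_mult_nth green_def loop_gf_def genfun_nth
    by (intro sum.cong) (simp_all add: paths_eq loops_eq)
  finally show "fps_nth (fps_XD (green U x)) n = fps_nth (green U x * loop_gf U {x}) n" .
qed

text \<open>\<open>F\<close> is the product of the Green functions of the vertices of \<eta>, each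
  in \<open>U\<close> without the earlier ones. Their logarithmic derivatives add up: a loop meeting
  \<eta> is counted once, at the vertex it visits that comes first in the order of \<eta>.\<close>

lemma path_gf_logarithmic_derivative:
  assumes "successively adjacent \<eta>" "distinct \<eta>" "set \<eta> \<subseteq> U"
  shows "\<exists>F. path_gf U \<eta> = fps_X ^ length \<eta> * F \<and> fps_nth F 0 = 1 \<and> fps_XD F = F * loop_gf U (set \<eta>)"
  using assms
proof (induction \<eta> arbitrary: U)
  case Nil
  have "loops U {} = {}" by (auto simp: loops_def)
  then show ?case
    using fps_XD_const[of "1::real"] by (intro exI[of _ 1]) (simp add: path_gf_Nil loop_gf_def)
next
  case (Cons x \<eta>)
  then have "successively adjacent \<eta>" "distinct \<eta>" "set \<eta> \<subseteq> U - {x}" "x \<in> U"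
    by (auto simp: successively_Cons)
  then obtain F where F: "path_gf (U - {x}) \<eta> = fps_X ^ length \<eta> * F" "fps_nth F 0 = 1"
      "fps_XD F = F * loop_gf (U - {x}) (set \<eta>)"
    using Cons.IH by blast
  have "loop_gf U (set (x # \<eta>)) = loop_gf U {x} + loop_gf (U - {x}) (set \<eta>)"
    using loop_gf_insert[of U x "set \<eta>"] graded_loops[of "insert x (set \<eta>)" U] by simp
  then have "fps_XD (green U x * F) = green U x * F * loop_gf U (set (x # \<eta>))"
    using \<open>x \<in> U\<close> F(3) by (simp add: fps_XD_mult fps_XD_green algebra_simps)
  moreover have "path_gf U (x # \<eta>) = fps_X ^ length (x # \<eta>) * (green U x * F)"
    using Cons.prems(1) \<open>x \<in> U\<close> by (simp add: path_gf_Cons F(1) mult_ac)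
  moreover have "fps_nth (green U x * F) 0 = 1"
    using F(2) \<open>x \<in> U\<close> by (simp add: green_nth_0)
  ultimately show ?case by blast
qed

end

section \<open>From the logarithmic derivative to the exponential of the loop measure\<close>

theorem theorem1p13:
  fixes lam :: "(int ^ 'd::finite) list \<Rightarrow> real"
    and z :: real
    and \<eta> :: "(int ^ 'd) list"
  assumes "0 \<le> z"
    and "loop_activities lam"
    and "self_avoiding_walk \<eta>"
  shows "loop_erased_weight lam z \<eta> =
           (\<Sum>\<^sub>\<infinity>\<omega>\<in>{\<omega>. walk \<omega> \<and> LE \<omega> = \<eta>}. ennreal (weight lam z \<omega>)) \<and>
         (\<Sum>\<^sub>\<infinity>\<omega>\<in>{\<omega>. walk \<omega> \<and> LE \<omega> = \<eta>}. ennreal (weight lam z \<omega>)) =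
           ennreal (z ^ steps \<eta>) * exp_ennreal (loop_measure lam z (set \<eta>))"
proof -
  interpret activities lam by unfold_locales (rule assms(2))
  let ?L = "loop_product lam" and ?P = "paths UNIV \<eta>" and ?C = "loops UNIV (set \<eta>)"
  have \<eta>: "\<eta> \<noteq> []" "successively adjacent \<eta>" "distinct \<eta>"
    using assms(3) by (auto simp: self_avoiding_walk_def walk_iff)
  obtain F where F: "path_gf UNIV \<eta> = fps_X ^ length \<eta> * F" "fps_nth F 0 = 1"
      "fps_XD F = F * loop_gf UNIV (set \<eta>)"
    using path_gf_logarithmic_derivative[OF \<eta>(2,3)] by blast
  \<comment> \<open>The loop measure as a power series: dividing each weight by the number of steps
    inverts the Euler operator on \<open>loop_gf\<close>.\<close>
  define M where "M = genfun steps (\<lambda>\<omega>. ?L \<omega> / real (steps \<omega>)) ?C"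
  have gC: "graded steps ?C" by (intro graded_length_of_steps graded_loops) simp
  have gP: "graded steps ?P" by (intro graded_length_of_steps graded_paths)
  have steps_pos: "0 < steps \<omega>" if "\<omega> \<in> ?C" for \<omega> using that by (auto simp: loops_def steps_def)
  have M0: "fps_nth M 0 = 0"
    unfolding M_def genfun_nth using steps_pos by (intro sum.neutral) auto
  have "fps_XD M = loop_gf UNIV (set \<eta>)"
  proof (rule fps_ext)
    fix n
    show "fps_nth (fps_XD M) n = fps_nth (loop_gf UNIV (set \<eta>)) n"
      unfolding M_def loop_gf_def fps_XD_nth genfun_nth sum_distrib_left
      by (intro sum.cong) (auto dest: steps_pos)
  qed
  then have "fps_X * fps_deriv F = fps_X * (F * fps_deriv M)"
    using F(3) by (simp add: fps_XD_def mult_ac)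
  then have "fps_deriv F = F * fps_deriv M" by simp
  then have exp: "F = fps_exp 1 oo M"
    using F(2) M0 by (rule fps_deriv_eq_mult_imp_eq_exp)
  have nnP: "0 \<le> ?L \<omega>" if "\<omega> \<in> ?P" for \<omega> using that by (intro loop_product_nonneg) (simp add: paths_def)
  have nnC: "0 \<le> ?L \<omega>" if "\<omega> \<in> ?C" for \<omega> using that by (intro loop_product_nonneg) (simp add: loops_def)
  have nnM: "fps_nonneg M" unfolding M_def by (rule fps_nonneg_genfun) (use nnC in auto)
  \<comment> \<open>\<open>path_gf\<close> counts vertices, one more than steps; the resulting
    factor \<open>fps_X\<close> is cancelled below.\<close>
  have "fps_X ^ 1 * genfun steps ?L ?P = path_gf UNIV \<eta>"
    unfolding path_gf_def
    by (rule genfun_fps_X_power_mult[symmetric]) (use \<eta>(1) in \<open>auto simp: paths_def steps_def Suc_le_eq\<close>)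
  also have "\<dots> = fps_X ^ 1 * (fps_X ^ steps \<eta> * F)"
    using \<eta>(1) F(1) by (cases \<eta>) (auto simp: steps_def mult.assoc)
  finally have gen: "genfun steps ?L ?P = fps_X ^ steps \<eta> * F" by simp
  have nnF: "fps_nonneg F"
    unfolding fps_nonneg_def
  proof
    fix n
    \<comment> \<open>Multiplication by \<open>fps_X ^ steps \<eta>\<close> only shifts, so the
      coefficients of \<open>F\<close> are coefficients of a generating function with nonnegative
      weights.\<close>
    have "0 \<le> fps_nth (fps_X ^ steps \<eta> * F) (n + steps \<eta>)"
      using fps_nonneg_genfun[of ?P ?L steps] nnP unfolding gen[symmetric] fps_nonneg_def by blast
    then show "0 \<le> fps_nth F n" by (simp add: fps_X_power_mult_nth)
  qed
  have P: "{\<omega>. walk \<omega> \<and> LE \<omega> = \<eta>} = ?P" using \<eta>(1) by (auto simp: walk_iff paths_def)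
  then have "weight lam z \<omega> = ?L \<omega> * z ^ steps \<omega>" if "\<omega> \<in> ?P" for \<omega> using that by (blast intro: weight_eq)
  then have "(\<Sum>\<^sub>\<infinity>\<omega>\<in>{\<omega>. walk \<omega> \<and> LE \<omega> = \<eta>}. ennreal (weight lam z \<omega>)) = (\<Sum>\<^sub>\<infinity>\<omega>\<in>?P. ennreal (?L \<omega> * z ^ steps \<omega>))"
    unfolding P by (intro infsum_cong) simp
  also have "\<dots> = fps_eval_ennreal z (genfun steps ?L ?P)"
    using fps_eval_ennreal_genfun[OF gP assms(1), of ?L] nnP by simp
  also have "\<dots> = ennreal (z ^ steps \<eta>) * exp_ennreal (fps_eval_ennreal z M)"
    unfolding gen using assms(1) nnF nnM M0
    by (simp add: fps_eval_ennreal_fps_X_power_mult) (simp add: exp fps_eval_ennreal_exp)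
  also have "fps_eval_ennreal z M = (\<Sum>\<^sub>\<infinity>\<omega>\<in>?C. ennreal (?L \<omega> / real (steps \<omega>) * z ^ steps \<omega>))"
    unfolding M_def by (rule fps_eval_ennreal_genfun[OF gC assms(1)]) (use nnC in auto)
  \<comment> \<open>Sorting by starting vertex matches the outer sum in the loop measure.\<close>
  also have "\<dots> = (\<Sum>\<^sub>\<infinity>x. \<Sum>\<^sub>\<infinity>\<omega>\<in>{\<omega> \<in> ?C. hd \<omega> = x}. ennreal (?L \<omega> / real (steps \<omega>) * z ^ steps \<omega>))"
    by (rule infsum_group_ennreal)
  also have "\<dots> = loop_measure lam z (set \<eta>)"
    unfolding loop_measure_def
  proof (intro infsum_cong infsum_cong_neutral)
    fix x \<omega>
    have C_iff: "\<omega> \<in> ?C \<and> hd \<omega> = x \<longleftrightarrow> walk_from_to \<omega> x x \<and> 1 \<le> steps \<omega> \<and> set \<omega> \<inter> set \<eta> \<noteq> {}"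
      by (cases "\<omega> = []") (auto simp: loops_def walk_from_to_def walk_iff steps_def hd_conv_nth last_conv_nth)
    let ?B = "{\<omega>. walk_from_to \<omega> x x \<and> 1 \<le> steps \<omega>}"
    let ?g = "\<lambda>\<omega>. of_bool (set \<omega> \<inter> set \<eta> \<noteq> {}) * ennreal (weight lam z \<omega> / real (steps \<omega>))"
    show "ennreal (?L \<omega> / real (steps \<omega>) * z ^ steps \<omega>) = 0" if "\<omega> \<in> {\<omega> \<in> ?C. hd \<omega> = x} - ?B"
      using that C_iff by blast
    show "?g \<omega> = 0" if "\<omega> \<in> ?B - {\<omega> \<in> ?C. hd \<omega> = x}"
      using that C_iff by auto
    show "ennreal (?L \<omega> / real (steps \<omega>) * z ^ steps \<omega>) = ?g \<omega>" if "\<omega> \<in> {\<omega> \<in> ?C. hd \<omega> = x} \<inter> ?B"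
      using that C_iff by (auto simp: walk_from_to_def weight_eq)
  qed
  finally show ?thesis by (simp add: loop_erased_weight_def)
qed

end
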